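(* Given polynomials $f$ and $g$ (with complex coefficients), define maps from $\mathfrak{g}$ to $\mathbb{R}$ by $$\phi(B)=\mathrm{Im}\,\mathrm{tr}\{f(B)\}\qquad\text{and}\qquad\psi(B)=\mathrm{Re}\,\langle e_1|g(B)e_1\rangle .$$ Taking $\phi$ as the Hamiltonian, $$\dot\psi(B)=\mathrm{Re}\,\big\langle e_1\big|Bf'(B)\big(g(B)+g(B)^\dagger\big)e_1\big\rangle-2\psi(B)\,\mathrm{Re}\,\langle e_1|Bf'(B)e_1\rangle .$$ In particular, if $d\mu$ is the spectral measure associated to $e_1$ and a CMV matrix $\mathcal{C}$ (evolving under this flow), then writing $F(z)=2\,\mathrm{Re}\,zf'(z)$, we have $$\partial_t\int G\,d\mu=\int FG\,d\mu-\int F\,d\mu\int G\,d\mu$$ for any function $G:S^1\to\mathbb{R}$.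
   Context: $\mathfrak{g}$ is the set of $n\times n$ complex matrices viewed as a real manifold. Write $\mathfrak{g}=\mathfrak{l}\oplus\mathfrak{a}$ (real vector spaces), with $\mathfrak{a}=\{A:A=-A^\dagger\}$ and $\mathfrak{l}$ the lower triangular matrices with real diagonal; $\pi_{\mathfrak l},\pi_{\mathfrak a}$ are the projections and $R=\pi_{\mathfrak l}-\pi_{\mathfrak a}$. Let $\langle X,Y\rangle=\mathrm{Im}\,\mathrm{tr}(XY)$ for matrices, and define $\nabla\phi$ by $\frac{d}{dt}|_{t=0}\phi(B+tC)=\langle\nabla\phi|_B,C\rangle$. The (Gelfand--Dikij) Poisson bracket is, with $X=\nabla\phi|_B$, $Y=\nabla\psi|_B$, $$\{\phi,\psi\}|_B=\tfrac12\langle R(XB),YB\rangle-\tfrac12\langle R(BX),BY\rangle ,$$ and the flow with Hamiltonian $\phi$ is the one satisfying $\dot\psi=\{\phi,\psi\}$ for all $\psi$. This flow preserves the set of CMV matrices. $\langle e_1|Ae_1\rangle$ is the standard inner product, $e_1=[1,0,\dots,0]^T$. The spectral measure of a unitary $\mathcal{C}$ and $e_1$ is the probability measure on the unit circle $S^1$ with $\langle e_1|h(\mathcal{C})e_1\rangle=\int h\,d\mu$ for all $h$. CMV matrices: given $\alpha_0,\ldots,\alpha_{n-2}$ in the open unit disk and $\alpha_{n-1}\in S^1$, put $\rho_k=\sqrt{1-|\alpha_k|^2}$, $\Xi_k=\begin{bmatrix}\bar\alpha_k&\rho_k\\ \rho_k&-\alpha_k\end{bmatrix}$ for $0\le k\le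 n-2$, $\Xi_{-1}=[1]$, $\Xi_{n-1}=[\bar\alpha_{n-1}]$. The CMV matrix is $\mathcal{C}=\mathcal{L}\mathcal{M}$ with $n\times n$ block-diagonal $\mathcal{L}=\mathrm{diag}(\Xi_0,\Xi_2,\ldots)$, $\mathcal{M}=\mathrm{diag}(\Xi_{-1},\Xi_1,\Xi_3,\ldots)$. *)

theory Defs
  imports "HOL-Probability.Probability" "HOL-Computational_Algebra.Polynomial"
begin

type_synonym 'n cmat = "complex^'n^'n"

text \<open>The order on the index type \<open>'n\<close> is only needed to speak of the first basis vector, of
  lower triangular matrices and of the position of the blocks of a CMV matrix. Products of matrices
  are \<open>(**)\<close>; \<open>(*)\<close> and \<open>(^)\<close> on \<open>complex^'n^'n\<close> are the entrywise operations.\<close>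

definition dagger :: "'n::finite cmat \<Rightarrow> 'n cmat" where
  "dagger A = (\<chi> i j. cnj (A $ j $ i))"

definition cinner :: "complex^'n::finite \<Rightarrow> complex^'n \<Rightarrow> complex" where
  "cinner u v = (\<Sum>i\<in>UNIV. cnj (u $ i) * v $ i)"

definition e1 :: "complex^'n::{finite,linorder}" where
  "e1 = axis (Min UNIV) 1"

primrec matrix_pow :: "'n::finite cmat \<Rightarrow> nat \<Rightarrow> 'n cmat" where
  "matrix_pow A 0 = mat 1"
| "matrix_pow A (Suc k) = A ** matrix_pow A k"

definition matrix_poly :: "complex poly \<Rightarrow> 'n::finite cmat \<Rightarrow> 'n cmat" where
  "matrix_poly p A = (\<Sum>k\<le>degree p. mat (coeff p k) ** matrix_pow A k)"


definition antihermitian_matrices :: "'n::finite cmat set" where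
  "antihermitian_matrices = {A. A = - dagger A}"

definition lower_real_diag_matrices :: "'n::{finite,linorder} cmat set" where
  "lower_real_diag_matrices = {A. (\<forall>i j. i < j \<longrightarrow> A $ i $ j = 0) \<and> (\<forall>i. A $ i $ i \<in> \<real>)}"

definition proj_l :: "'n::{finite,linorder} cmat \<Rightarrow> 'n cmat" where
  "proj_l X = (THE L. L \<in> lower_real_diag_matrices \<and>
                 (\<exists>A\<in>antihermitian_matrices. X = L + A))"

definition proj_a :: "'n::{finite,linorder} cmat \<Rightarrow> 'n cmat" where
  "proj_a X = (THE A. A \<in> antihermitian_matrices \<and>
                 (\<exists>L\<in>lower_real_diag_matrices. X = L + A))"

definition R_op :: "'n::{finite,linorder} cmat \<Rightarrow> 'n cmat" where
  "R_op X = proj_l X - proj_a X"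

definition pairing :: "'n::finite cmat \<Rightarrow> 'n cmat \<Rightarrow> real" where
  "pairing X Y = Im (trace (X ** Y))"

text \<open>Unique if it exists, as the pairing is nondegenerate; meaningful only at points of
  differentiability.\<close>
definition grad :: "('n::finite cmat \<Rightarrow> real) \<Rightarrow> 'n cmat \<Rightarrow> 'n cmat" where
  "grad \<phi> B = (THE X. \<forall>C. ((\<lambda>t. \<phi> (B + t *\<^sub>R C)) has_real_derivative pairing X C) (at 0))"

definition poisson ::
  "('n::{finite,linorder} cmat \<Rightarrow> real) \<Rightarrow> ('n cmat \<Rightarrow> real) \<Rightarrow> 'n cmat \<Rightarrow> real" where
  "poisson \<phi> \<psi> B =
     (let X = grad \<phi> B; Y = grad \<psi> B
      in 1/2 * pairing (R_op (X ** B)) (Y ** B) - 1/2 * pairing (R_op (B ** X)) (B ** Y))"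

primrec times_cont_diff :: "nat \<Rightarrow> ('a::real_normed_vector \<Rightarrow> real) \<Rightarrow> bool" where
  "times_cont_diff 0 f \<longleftrightarrow> continuous_on UNIV f"
| "times_cont_diff (Suc k) f \<longleftrightarrow>
     (\<exists>f'. (\<forall>x. (f has_derivative f' x) (at x)) \<and> (\<forall>v. times_cont_diff k (\<lambda>x. f' x v)))"

definition smooth_fun :: "('a::real_normed_vector \<Rightarrow> real) \<Rightarrow> bool" where
  "smooth_fun f \<longleftrightarrow> (\<forall>k. times_cont_diff k f)"

definition hamiltonian_flow ::
  "('n::{finite,linorder} cmat \<Rightarrow> real) \<Rightarrow> real set \<Rightarrow> (real \<Rightarrow> 'n cmat) \<Rightarrow> bool" where
  "hamiltonian_flow \<phi> T B \<longleftrightarrow>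
     (\<forall>t\<in>T. \<forall>\<psi>. smooth_fun \<psi> \<longrightarrow>
        ((\<lambda>s. \<psi> (B s)) has_real_derivative poisson \<phi> \<psi> (B t)) (at t))"


text \<open>Position of an index in the order, counted from 0.\<close>
definition idx :: "'n::{finite,linorder} \<Rightarrow> nat" where
  "idx i = card {j. j < i}"

text \<open>Entry \<open>(a, b)\<close>, \<open>a, b \<in> {0, 1}\<close>, of the block \<open>\<Xi>\<^sub>k\<close>, for \<open>0 \<le> k \<le> n - 1\<close>; the block
  \<open>\<Xi>\<^sub>n\<^sub>-\<^sub>1\<close> is \<open>1 \<times> 1\<close>, so that there only the entry \<open>(0, 0)\<close> is used.\<close>
definition Xi :: "nat \<Rightarrow> (nat \<Rightarrow> complex) \<Rightarrow> nat \<Rightarrow> nat \<Rightarrow> nat \<Rightarrow> complex" where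
  "Xi n \<alpha> k a b =
     (if k = n - 1 then cnj (\<alpha> (n - 1))
      else if a = 0 \<and> b = 0 then cnj (\<alpha> k)
      else if a = 1 \<and> b = 1 then - \<alpha> k
      else complex_of_real (sqrt (1 - (cmod (\<alpha> k))\<^sup>2)))"

text \<open>\<open>\<Xi>\<^sub>k\<close> with \<open>k \<ge> 0\<close> occupies the rows and columns \<open>k\<close> and \<open>k + 1\<close> (only \<open>k\<close> if \<open>k = n - 1\<close>),
  with \<open>k\<close> even in \<open>\<L>\<close> and odd in \<open>\<M>\<close>; the leading block \<open>\<Xi>\<^sub>-\<^sub>1 = [1]\<close> shifts \<open>\<M>\<close> by one.\<close>
definition cmv_L :: "(nat \<Rightarrow> complex) \<Rightarrow> 'n::{finite,linorder} cmat" where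
  "cmv_L \<alpha> = (\<chi> i j. let p = idx i; q = idx j in
      if p div 2 = q div 2 then Xi CARD('n) \<alpha> (2 * (p div 2)) (p mod 2) (q mod 2) else 0)"

definition cmv_M :: "(nat \<Rightarrow> complex) \<Rightarrow> 'n::{finite,linorder} cmat" where
  "cmv_M \<alpha> = (\<chi> i j. let p = idx i; q = idx j in
      if p = 0 \<and> q = 0 then 1
      else if p = 0 \<or> q = 0 then 0
      else if (p - 1) div 2 = (q - 1) div 2
      then Xi CARD('n) \<alpha> (2 * ((p - 1) div 2) + 1) ((p - 1) mod 2) ((q - 1) mod 2)
      else 0)"

definition is_CMV :: "'n::{finite,linorder} cmat \<Rightarrow> bool" where
  "is_CMV C \<longleftrightarrow>
     (\<exists>\<alpha>. (\<forall>k < CARD('n) - 1. cmod (\<alpha> k) < 1) \<and> cmod (\<alpha> (CARD('n) - 1)) = 1 \<and>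
          C = cmv_L \<alpha> ** cmv_M \<alpha>)"


text \<open>Functional calculus: \<open>h(C)\<close> acts as \<open>h(z)\<close> on the eigenspace of each eigenvalue \<open>z\<close>. For
  diagonalizable (in particular unitary) \<open>C\<close> this determines \<open>h(C)\<close>, for an arbitrary function
  \<open>h\<close>.\<close>
definition matrix_fun :: "(complex \<Rightarrow> complex) \<Rightarrow> 'n::finite cmat \<Rightarrow> 'n cmat" where
  "matrix_fun h C = (THE H. \<forall>z v. C *v v = z *s v \<longrightarrow> H *v v = h z *s v)"

text \<open>The spectral measure of a unitary matrix has finite support. It is taken on the
  \<open>\<sigma>\<close>-algebra of all subsets of the circle, so that every function on the circle is integrable.\<close>
definition is_spectral_measure ::
  "'n::finite cmat \<Rightarrow> complex^'n \<Rightarrow> complex measure \<Rightarrow> bool" where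
  "is_spectral_measure C v \<mu> \<longleftrightarrow>
     prob_space \<mu> \<and> space \<mu> = sphere 0 1 \<and> sets \<mu> = Pow (sphere 0 1) \<and>
     (\<forall>h. cinner v (matrix_fun h C *v v) = (\<integral>z. h z \<partial>\<mu>))"

end

theory Submission
  imports Defs "HOL-Computational_Algebra.Fundamental_Theorem_Algebra"
begin

text \<open>Writing \<open>Z = B f'(B)\<close> for the Hamiltonian \<open>\<phi>\<close>, invariance of the pairing turns the bracket
  \<open>{\<phi>, \<psi>}\<close> into the derivative of \<open>\<psi>\<close> in the direction \<open>[B, \<pi>\<^sub>\<l> Z]\<close>. Along this direction \<open>g(B)\<close> changes
  by \<open>[g(B), \<pi>\<^sub>\<l> Z]\<close>, and the action of \<open>\<pi>\<^sub>\<l> Z\<close> and its adjoint on \<open>e\<^sub>1\<close> is explicit. The flow has the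
  Lax form \<open>C' = [A, C]\<close> with \<open>A\<close> antihermitian, and any solution of \<open>D' = [A, D]\<close> has constant
  Frobenius norm. With \<open>D = C C\<^sup>\<dagger> - 1\<close> and \<open>D = q(C)\<close> this shows that \<open>C\<close> stays unitary and keeps
  an annihilating polynomial \<open>q\<close> with simple roots, so that an arbitrary function \<open>G\<close> may be replaced by
  one polynomial interpolating it at the roots of \<open>q\<close>, for all times at once.\<close>

subsection \<open>Matrix algebra\<close>

lemma bilinear_matrix_mult: "bilinear ((**) :: 'n::finite cmat \<Rightarrow> 'n cmat \<Rightarrow> 'n cmat)"
  unfolding bilinear_def
  by (auto intro!: linearI simp: matrix_matrix_mult_def vec_eq_iff sum.distrib algebra_simps
      scaleR_sum_right)

text \<open>Provides the product rule for derivatives, along with the distributive laws collected in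
  \<open>matrix_distribs\<close>.\<close>

interpretation matrix_mult: bounded_bilinear "(**) :: 'n::finite cmat \<Rightarrow> 'n cmat \<Rightarrow> 'n cmat"
  using bilinear_matrix_mult by (simp add: bilinear_conv_bounded_bilinear)

lemmas matrix_distribs = matrix_mult.add_left matrix_mult.add_right
  matrix_mult.diff_left matrix_mult.diff_right matrix_mult.minus_left matrix_mult.minus_right

text \<open>Complex scalars act throughout as products with \<open>mat a\<close>;
  \<open>scaleR\<close> covers the real ones.\<close>

lemma mat_mult_nth: "(mat a ** A) $ i $ j = a * A $ i $ j" for A :: "'n::finite cmat"
  by (simp add: matrix_matrix_mult_def mat_def if_distrib[of "\<lambda>x. x * _"] cong: if_cong)

lemma mult_mat_nth: "(A ** mat a) $ i $ j = a * A $ i $ j" for A :: "'n::finite cmat"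
  by (simp add: matrix_matrix_mult_def mat_def if_distrib[of "(*) _"] mult.commute cong: if_cong)

lemma mat_mult_commute: "mat a ** A = A ** mat a" for A :: "'n::finite cmat"
  by (simp add: vec_eq_iff mat_mult_nth mult_mat_nth)

lemma mat_add: "mat (a + b) = mat a + (mat b :: 'n::finite cmat)"
  by (simp add: mat_def vec_eq_iff)

lemma mat_minus: "mat (- a) = - (mat a :: 'n::finite cmat)"
  by (simp add: mat_def vec_eq_iff)

lemma mat_mat: "mat a ** mat b = (mat (a * b) :: 'n::finite cmat)"
  by (simp add: vec_eq_iff mat_mult_nth) (simp add: mat_def)

lemma mat_0 [simp]: "mat 0 = (0 :: 'n::finite cmat)"
  by (simp add: mat_def vec_eq_iff)

lemma mat_mult_vec: "mat a *v v = a *s v" for v :: "complex^'n::finite"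
  by (simp add: vec_eq_iff matrix_vector_mult_def mat_def if_distrib[of "\<lambda>x. x * _"] cong: if_cong)

lemma mult_smult_vec: "A *v (a *s v) = a *s (A *v v)" for A :: "'n::finite cmat"
proof -
  have "A *v (mat a *v v) = mat a *v (A *v v)"
    by (simp only: matrix_vector_mul_assoc mat_mult_commute[of a A])
  then show ?thesis by (simp only: mat_mult_vec)
qed

lemma mult_scaleR_vec: "A *v (r *\<^sub>R v) = r *\<^sub>R (A *v v)" for A :: "'n::finite cmat"
  by (simp add: vec_eq_iff matrix_vector_mult_def scaleR_sum_right)

subsection \<open>Polynomials of matrices\<close>

lemma matrix_poly_0 [simp]: "matrix_poly 0 A = 0"
  by (simp add: matrix_poly_def)

text \<open>Horner's recursion, the basis of the later inductions over \<open>pCons\<close>.\<close>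

lemma matrix_poly_pCons: "matrix_poly (pCons a p) A = mat a + A ** matrix_poly p A"
\<comment> \<open>The degree of \<open>pCons a p\<close> is \<open>Suc (degree p)\<close> only for
  nonzero \<open>p\<close>; the index shift relies on that.\<close>
proof (cases "p = 0")
  case True
  then show ?thesis by (simp add: matrix_poly_def)
next
  case False
  then have "matrix_poly (pCons a p) A
      = mat a + (\<Sum>k\<le>degree p. mat (coeff p k) ** (A ** matrix_pow A k))"
    by (simp add: matrix_poly_def sum.atMost_Suc_shift del: sum.atMost_Suc)
  also have "(\<Sum>k\<le>degree p. mat (coeff p k) ** (A ** matrix_pow A k)) = A ** matrix_poly p A"
    by (simp add: matrix_poly_def matrix_mult.sum_right matrix_mul_assoc flip: mat_mult_commute)
  finally show ?thesis .
qed

lemma matrix_poly_1 [simp]: "matrix_poly 1 A = mat 1"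
  by (simp add: one_pCons matrix_poly_pCons)

lemma matrix_poly_linear: "matrix_poly [:a, 1:] A = mat a + A"
  by (simp add: matrix_poly_pCons)

lemma matrix_poly_add: "matrix_poly (p + q) A = matrix_poly p A + matrix_poly q A"
  by (induction p q rule: poly_induct2) (auto simp: matrix_poly_pCons mat_add matrix_distribs)

lemma matrix_poly_smult: "matrix_poly (smult c p) A = mat c ** matrix_poly p A"
proof (induction p)
  case (pCons a p)
  have "A ** (mat c ** matrix_poly p A) = mat c ** (A ** matrix_poly p A)"
    by (simp only: matrix_mul_assoc mat_mult_commute[of c A])
  with pCons show ?case
    by (simp add: matrix_poly_pCons matrix_distribs mat_mat)
qed simp

lemma matrix_poly_diff: "matrix_poly (p - q) A = matrix_poly p A - matrix_poly q A"
  using matrix_poly_add[of "p - q" q A] by simp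

lemma matrix_poly_sum: "matrix_poly (sum p S) A = (\<Sum>i\<in>S. matrix_poly (p i) A)"
  by (induction S rule: infinite_finite_induct) (auto simp: matrix_poly_add)

lemma matrix_poly_mult: "matrix_poly (p * q) A = matrix_poly p A ** matrix_poly q A"
  by (induction p)
    (auto simp: matrix_poly_pCons matrix_poly_add matrix_poly_smult matrix_distribs matrix_mul_assoc)

lemma matrix_poly_commute_matrix:
  assumes "A ** M = M ** A"
  shows "matrix_poly p A ** M = M ** matrix_poly p A"
proof (induction p)
  case (pCons a p)
  have "A ** matrix_poly p A ** M = A ** M ** matrix_poly p A"
    using pCons by (simp flip: matrix_mul_assoc)
  also have "\<dots> = M ** (A ** matrix_poly p A)"
    by (simp add: assms matrix_mul_assoc)
  finally show ?case
    by (simp add: matrix_poly_pCons matrix_distribs mat_mult_commute)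
qed simp

lemma matrix_poly_commute: "A ** matrix_poly p A = matrix_poly p A ** A"
  by (rule matrix_poly_commute_matrix[symmetric]) simp

lemma matrix_poly_eigenvector:
  assumes "A *v v = z *s v"
  shows "matrix_poly p A *v v = poly p z *s v"
proof (induction p)
  case (pCons a p)
  have "A *v (matrix_poly p A *v v) = (z * poly p z) *s v"
    by (simp add: pCons mult_smult_vec assms mult.commute)
  then show ?case
    by (simp add: matrix_poly_pCons matrix_vector_mult_add_rdistrib mat_mult_vec
        vec.scale_left_distrib flip: matrix_vector_mul_assoc)
qed simp

subsection \<open>The adjoint\<close>

lemma dagger_nth [simp]: "dagger A $ i $ j = cnj (A $ j $ i)"
  by (simp add: dagger_def)

lemma dagger_dagger [simp]: "dagger (dagger A) = A"
  by (simp add: vec_eq_iff)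

lemma dagger_0 [simp]: "dagger 0 = 0"
  by (simp add: vec_eq_iff)

lemma dagger_add: "dagger (A + B) = dagger A + dagger B"
  by (simp add: vec_eq_iff)

lemma dagger_diff: "dagger (A - B) = dagger A - dagger B"
  by (simp add: vec_eq_iff)

lemma dagger_mat: "dagger (mat a) = mat (cnj a)"
  by (simp add: vec_eq_iff mat_def)

lemma dagger_mult: "dagger (A ** B) = dagger B ** dagger A"
  by (simp add: vec_eq_iff matrix_matrix_mult_def mult.commute)

lemma linear_dagger: "linear dagger"
  by (rule linearI) (simp_all add: vec_eq_iff)

lemma bounded_linear_dagger: "bounded_linear dagger"
  using linear_dagger by (simp add: linear_conv_bounded_linear)

lemma trace_dagger: "trace (dagger A) = cnj (trace A)"
  by (simp add: trace_def)

text \<open>Links the Euclidean structure of the type with traces, so that trace identities yield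
  statements about norms and derivatives.\<close>

lemma inner_eq_trace: "A \<bullet> B = Re (trace (dagger A ** B))" for A B :: "'n::finite cmat"
proof -
  have "A \<bullet> B = (\<Sum>i\<in>UNIV. \<Sum>j\<in>UNIV. Re (cnj (A $ i $ j) * B $ i $ j))"
    by (simp add: inner_vec_def inner_complex_def)
  also have "\<dots> = (\<Sum>j\<in>UNIV. \<Sum>i\<in>UNIV. Re (cnj (A $ i $ j) * B $ i $ j))"
    by (rule sum.swap)
  finally show ?thesis
    by (simp add: trace_def matrix_matrix_mult_def)
qed

lemma dagger_mult_self_eq_0:
  assumes "dagger A ** A = 0"
  shows "A = (0 :: 'n::finite cmat)"
proof -
  have "A \<bullet> A = 0"
    using assms by (simp add: inner_eq_trace trace_def)
  then show ?thesis by simp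
qed

lemma cinner_dagger: "cinner u (A *v v) = cinner (dagger A *v u) v"
proof -
  have "cinner u (A *v v) = (\<Sum>i\<in>UNIV. \<Sum>j\<in>UNIV. cnj (u $ i) * A $ i $ j * v $ j)"
    by (simp add: cinner_def matrix_vector_mult_def sum_distrib_left mult.assoc)
  also have "\<dots> = (\<Sum>j\<in>UNIV. \<Sum>i\<in>UNIV. cnj (u $ i) * A $ i $ j * v $ j)"
    by (rule sum.swap)
  finally show ?thesis
    by (simp add: cinner_def matrix_vector_mult_def sum_distrib_left sum_distrib_right mult_ac)
qed

lemma cinner_eq_inner: "Re (cinner u v) = u \<bullet> v"
  by (simp add: cinner_def inner_vec_def inner_complex_def)

subsection \<open>Gradients and projections\<close>

text \<open>Since Im z = Re (-i z), the pairing is the Frobenius form composed with a real linear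
  bijection in the first argument; it inherits nondegeneracy and the representation of
  functionals.\<close>

lemma pairing_eq_inner: "pairing X Y = (mat \<i> ** dagger X) \<bullet> Y"
proof -
  have "dagger (mat \<i> ** dagger X) ** Y = mat (- \<i>) ** (X ** Y)"
    by (simp add: dagger_mult dagger_mat matrix_mul_assoc mat_mult_commute[of "- \<i>" X])
  moreover have "trace (mat (- \<i>) ** (X ** Y)) = - \<i> * trace (X ** Y)"
    by (simp add: trace_def mat_mult_nth sum_distrib_left sum_negf)
  ultimately show ?thesis
    by (simp add: inner_eq_trace pairing_def)
qed

lemma pairing_diff_right: "pairing X (Y - Z) = pairing X Y - pairing X Z"
  by (simp add: pairing_eq_inner inner_diff_right)

text \<open>Gives the uniqueness behind the definite description in \<open>grad\<close>.\<close>

lemma pairing_nondegenerate: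
  assumes "\<And>C. pairing X C = pairing Y C"
  shows "X = Y"
proof -
  define U V where "U = mat \<i> ** dagger X" and "V = mat \<i> ** dagger Y"
  have "U \<bullet> C = V \<bullet> C" for C
    using assms[of C] unfolding U_def V_def by (simp only: pairing_eq_inner)
  from this[of "U - V"] have "(U - V) \<bullet> (U - V) = 0"
    by (simp only: inner_diff_left)
  then have "U = V"
    by simp
  moreover have "mat (- \<i>) ** U = dagger X" "mat (- \<i>) ** V = dagger Y"
    by (simp_all add: U_def V_def matrix_mul_assoc mat_mat)
  ultimately have "dagger (dagger X) = dagger (dagger Y)"
    by simp
  then show ?thesis
    by (simp only: dagger_dagger)
qed

lemma linear_functional_eq_pairing:
  fixes l :: "'n::finite cmat \<Rightarrow> real"
  assumes "linear l"
  obtains Y where "\<And>C. l C = pairing Y C"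
proof
  fix C
  \<comment> \<open>\<open>?a\<close> represents \<open>l\<close> in the Frobenius form; the witness
    undoes the twist by \<open>mat \<i>\<close> and \<open>dagger\<close>.\<close>
  let ?a = "adjoint l 1"
  have "mat \<i> ** dagger (dagger (mat (- \<i>) ** ?a)) = ?a"
    by (simp add: matrix_mul_assoc mat_mat)
  then show "l C = pairing (dagger (mat (- \<i>) ** ?a)) C"
    using adjoint_works[OF assms, of C 1] by (simp only: pairing_eq_inner inner_commute[of C]) simp
qed

text \<open>A total derivative yields all the directional derivatives that \<open>grad\<close> asks
  for, and nondegeneracy leaves only one candidate.\<close>

lemma grad_eqI:
  assumes "(\<psi> has_derivative l) (at B)" and "\<And>C. l C = pairing Y C"
  shows "grad \<psi> B = Y"
proof -
  have *: "((\<lambda>t. \<psi> (B + t *\<^sub>R C)) has_real_derivative pairing Y C) (at 0)" for C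
  proof -
    have "((\<lambda>t. B + t *\<^sub>R C) has_derivative (\<lambda>t. t *\<^sub>R C)) (at 0)"
      by (auto intro!: derivative_eq_intros)
    moreover have "(\<psi> has_derivative l) (at (B + 0 *\<^sub>R C))"
      using assms(1) by simp
    ultimately have "((\<lambda>t. \<psi> (B + t *\<^sub>R C)) has_derivative (\<lambda>t. l (t *\<^sub>R C))) (at 0)"
      using has_derivative_compose by blast
    moreover have "l (t *\<^sub>R C) = pairing Y C * t" for t
      using assms(2) by (simp add: pairing_eq_inner)
    ultimately show ?thesis
      by (simp add: has_field_derivative_def)
  qed
  show ?thesis
    unfolding grad_def
  proof (rule the_equality)
    fix X
    assume "\<forall>C. ((\<lambda>t. \<psi> (B + t *\<^sub>R C)) has_real_derivative pairing X C) (at 0)"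
    then show "X = Y"
      using * by (intro pairing_nondegenerate) (blast intro: DERIV_unique)
  qed (use * in blast)
qed

section \<open>Explicit form of the projections\<close>

definition lower_part :: "'n::{finite,linorder} cmat \<Rightarrow> 'n cmat" where
  "lower_part X = (\<chi> i j. if i < j then 0 else if i = j then of_real (Re (X $ i $ i))
                           else X $ i $ j + cnj (X $ j $ i))"

lemma lower_part_in: "lower_part X \<in> lower_real_diag_matrices"
  by (simp add: lower_part_def lower_real_diag_matrices_def)

lemma diff_lower_part_in: "X - lower_part X \<in> antihermitian_matrices"
  by (auto simp: lower_part_def antihermitian_matrices_def vec_eq_iff complex_eq_iff)

text \<open>Above the diagonal \<open>A\<close> must equal \<open>X\<close>, and antihermitian
  symmetry then fixes \<open>A\<close> below it; on the diagonal \<open>L\<close> takes the real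
  part and \<open>A\<close> the imaginary part. This is the origin of the formula for
  \<open>lower_part\<close>.\<close>

lemma decomposition_unique:
  assumes "X = L + A" "L \<in> lower_real_diag_matrices" "A \<in> antihermitian_matrices"
  shows "L = lower_part X"
proof -
  have L: "i < j \<Longrightarrow> L $ i $ j = 0" "Im (L $ i $ i) = 0" for i j
    using assms(2) by (auto simp: lower_real_diag_matrices_def complex_is_Real_iff)
  have A: "A $ i $ j = - cnj (A $ j $ i)" for i j
    using assms(3) by (metis (mono_tags, lifting) antihermitian_matrices_def dagger_nth
        mem_Collect_eq vector_uminus_component)
  have "L $ i $ j = lower_part X $ i $ j" for i j
  proof (cases i j rule: linorder_cases)
    case equal
    have "Re (A $ i $ i) = 0"
      using A[of i i] by (simp add: complex_eq_iff)
    then show ?thesis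
      using equal L(2)[of i] by (simp add: lower_part_def assms(1) complex_eq_iff)
  next
    case greater
    then show ?thesis
      using L(1)[of j i] A[of i j] by (auto simp: lower_part_def assms(1))
  qed (simp add: lower_part_def L)
  then show ?thesis by (simp add: vec_eq_iff)
qed

lemma proj_l_eq: "proj_l X = lower_part X"
  unfolding proj_l_def
proof (rule the_equality)
  show "lower_part X \<in> lower_real_diag_matrices \<and>
      (\<exists>A\<in>antihermitian_matrices. X = lower_part X + A)"
    using lower_part_in diff_lower_part_in[of X] by (auto intro!: bexI[of _ "X - lower_part X"])
qed (use decomposition_unique in blast)

lemma proj_a_eq: "proj_a X = X - lower_part X"
  unfolding proj_a_def
proof (rule the_equality)
  show "X - lower_part X \<in> antihermitian_matrices \<and>
      (\<exists>L\<in>lower_real_diag_matrices. X = L + (X - lower_part X))"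
    using lower_part_in diff_lower_part_in[of X] by (auto intro!: bexI[of _ "lower_part X"])
next
  fix A
  assume "A \<in> antihermitian_matrices \<and> (\<exists>L\<in>lower_real_diag_matrices. X = L + A)"
  then obtain L where "A \<in> antihermitian_matrices" "L \<in> lower_real_diag_matrices" "X = L + A"
    by blast
  then show "A = X - lower_part X"
    using decomposition_unique[of X L A] by simp
qed

lemma R_op_eq: "R_op X = 2 *\<^sub>R lower_part X - X"
  by (simp add: R_op_def proj_l_eq proj_a_eq scaleR_2)

text \<open>Only the gradient of the Hamiltonian enters explicitly: when it commutes with \<open>B\<close>, invariance
  of the pairing moves the commutator with \<open>B\<close> from \<open>\<nabla>\<psi>\<close> to \<open>R\<close>.\<close>
lemma poisson_eq_derivative:
  assumes "(\<psi> has_derivative l) (at B)" and "grad \<phi> B = X" and "X ** B = B ** X"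
  shows "poisson \<phi> \<psi> B = l (B ** lower_part (B ** X) - lower_part (B ** X) ** B)"
proof -
  have "linear l"
    using assms(1) has_derivative_linear by blast
  then obtain Y where Y: "\<And>C. l C = pairing Y C"
    using linear_functional_eq_pairing by blast
  have grad: "grad \<psi> B = Y"
    by (rule grad_eqI[OF assms(1) Y])
  let ?Z = "B ** X" and ?R = "R_op (B ** X)" and ?L = "lower_part (B ** X)"
  have "B ** ?Z = ?Z ** B"
    by (simp add: assms(3) flip: matrix_mul_assoc)
  \<comment> \<open>\<open>?Z\<close> commutes with \<open>B\<close>, so only the summand
    \<open>2 *\<^sub>R ?L\<close> of \<open>?R\<close> survives in the commutator, and its factor 2
    cancels the 1/2 of the bracket.\<close>
  then have R: "(1/2) *\<^sub>R (B ** ?R - ?R ** B) = B ** ?L - ?L ** B"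
    by (simp add: R_op_eq matrix_distribs matrix_mult.scaleR_left matrix_mult.scaleR_right
        scaleR_diff_right)
  have "pairing ?R (Y ** B) = pairing Y (B ** ?R)"
    using trace_mul_sym[of ?R "Y ** B"] by (simp add: pairing_def matrix_mul_assoc)
  moreover have "pairing ?R (B ** Y) = pairing Y (?R ** B)"
    using trace_mul_sym[of Y "?R ** B"] by (simp add: pairing_def matrix_mul_assoc)
  ultimately have "poisson \<phi> \<psi> B = 1/2 * pairing Y (B ** ?R - ?R ** B)"
    by (simp add: poisson_def Let_def grad assms(2,3) pairing_diff_right)
  also have "\<dots> = pairing Y ((1/2) *\<^sub>R (B ** ?R - ?R ** B))"
    by (simp add: pairing_eq_inner)
  finally show ?thesis by (simp only: R Y)
qed

subsection \<open>Derivatives of polynomials of matrices\<close>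

text \<open>The derivative \<open>D\<close> of \<open>p\<close> at \<open>B\<close> need not be computed: that it is a derivation determines it on
  commutators with \<open>B\<close>, and under the trace it is multiplication by \<open>p'(B)\<close>.\<close>
lemma matrix_poly_has_derivative:
  fixes B :: "'n::finite cmat"
  shows "\<exists>D. ((matrix_poly p) has_derivative D) (at B) \<and>
    (\<forall>R. D (B ** R - R ** B) = matrix_poly p B ** R - R ** matrix_poly p B) \<and>
    (\<forall>M C. B ** M = M ** B \<longrightarrow> trace (M ** D C) = trace (M ** matrix_poly (pderiv p) B ** C))"
proof (induction p)
  case 0
  show ?case
    by (rule exI[of _ "\<lambda>_. 0"]) (simp add: has_derivative_const trace_def)
next
  case (pCons a p)
  let ?P = "matrix_poly p B" and ?P' = "matrix_poly (pderiv p) B"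
  from pCons obtain D where D: "((matrix_poly p) has_derivative D) (at B)"
    and comm: "\<And>R. D (B ** R - R ** B) = ?P ** R - R ** ?P"
    and tr: "\<And>M C. B ** M = M ** B \<Longrightarrow> trace (M ** D C) = trace (M ** ?P' ** C)"
    by blast
  let ?D = "\<lambda>C. B ** D C + C ** ?P"
  have "((\<lambda>A. mat a + A ** matrix_poly p A) has_derivative (\<lambda>C. 0 + ?D C)) (at B)"
    by (intro has_derivative_add has_derivative_const matrix_mult.FDERIV has_derivative_ident D)
  then have "((matrix_poly (pCons a p)) has_derivative ?D) (at B)"
    by (simp add: matrix_poly_pCons[abs_def])
  moreover have "?D (B ** R - R ** B) = matrix_poly (pCons a p) B ** R - R ** matrix_poly (pCons a p) B"
    for R
    by (simp add: comm matrix_poly_pCons matrix_distribs matrix_mul_assoc mat_mult_commute[of a R])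
  moreover have "trace (M ** ?D C) = trace (M ** matrix_poly (pderiv (pCons a p)) B ** C)"
    if M: "B ** M = M ** B" for M C
  proof -
    \<comment> \<open>The induction hypothesis is applied with \<open>M ** B\<close> in place of
      \<open>M\<close>; this is why the trace formula is stated for every \<open>M\<close> commuting
      with \<open>B\<close>.\<close>
    have "B ** (M ** B) = M ** B ** B"
      by (simp add: matrix_mul_assoc M)
    then have "trace (M ** B ** D C) = trace (M ** B ** ?P' ** C)"
      by (rule tr)
    moreover have "trace (M ** C ** ?P) = trace (M ** ?P ** C)"
      using trace_mul_sym[of "M ** C" ?P] matrix_poly_commute_matrix[OF M, of p]
      by (simp add: matrix_mul_assoc)
    ultimately show ?thesis
      by (simp add: matrix_distribs trace_add matrix_mul_assoc pderiv_pCons matrix_poly_add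
          matrix_poly_pCons)
  qed
  ultimately show ?case by blast
qed

lemma grad_Im_trace_matrix_poly:
  "grad (\<lambda>B. Im (trace (matrix_poly f B))) B = matrix_poly (pderiv f) B"
proof -
  obtain D where D: "((matrix_poly f) has_derivative D) (at B)"
    and tr: "\<And>M C. B ** M = M ** B \<Longrightarrow>
      trace (M ** D C) = trace (M ** matrix_poly (pderiv f) B ** C)"
    using matrix_poly_has_derivative by blast
  have "linear (\<lambda>A :: 'a cmat. Im (trace A))"
    by (rule linearI) (simp_all add: trace_def sum_distrib_left sum.distrib)
  then have "bounded_linear (\<lambda>A :: 'a cmat. Im (trace A))"
    by (simp add: linear_conv_bounded_linear)
  then have "((\<lambda>A. Im (trace (matrix_poly f A))) has_derivative (\<lambda>C. Im (trace (D C)))) (at B)"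
    using D by (rule bounded_linear.has_derivative)
  then show ?thesis
    by (rule grad_eqI) (use tr[of "mat 1"] in \<open>simp add: pairing_def\<close>)
qed

subsection \<open>The bracket with a spectral function\<close>

lemma e1_nth: "e1 $ i = (if i = Min UNIV then 1 else 0)"
  by (simp add: e1_def axis_def)

lemma cinner_e1: "cinner e1 v = v $ Min UNIV"
  by (simp add: cinner_def e1_nth if_distrib[of cnj] if_distrib[of "\<lambda>x. x * _"] cong: if_cong)

lemma mult_e1_nth: "(A *v e1) $ i = A $ i $ Min UNIV"
  by (simp add: matrix_vector_mult_def e1_nth if_distrib[of "(*) _"] cong: if_cong)

text \<open>No entry of the first column lies above the diagonal. Below it
  \<open>lower_part Z\<close> agrees with \<open>Z + dagger Z\<close>; at the corner the latter
  counts the real part twice.\<close>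

lemma lower_part_e1: "lower_part Z *v e1 = (Z + dagger Z) *v e1 - Re (cinner e1 (Z *v e1)) *\<^sub>R e1"
  by (auto simp: vec_eq_iff mult_e1_nth cinner_e1 e1_nth lower_part_def complex_eq_iff leD)

text \<open>The adjoint is upper triangular with real diagonal, so \<open>e1\<close> is an
  eigenvector.\<close>

lemma dagger_lower_part_e1: "dagger (lower_part Z) *v e1 = Re (cinner e1 (Z *v e1)) *\<^sub>R e1"
proof -
  have "Min UNIV < j \<or> j = Min UNIV" for j :: 'a
    by (simp add: order_le_less[symmetric] eq_commute[of j])
  then show ?thesis
    by (auto simp: vec_eq_iff mult_e1_nth cinner_e1 e1_nth lower_part_def complex_eq_iff)
qed

text \<open>In the first product \<open>lower_part Z\<close> acts on the right \<open>e1\<close>, in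
  the second its adjoint acts on the left one. Each produces one product of the two expectations,
  whence the factor 2.\<close>

lemma Re_cinner_commutator_lower_part:
  assumes "Z ** P = P ** Z"
  shows "Re (cinner e1 ((P ** lower_part Z - lower_part Z ** P) *v e1)) =
    Re (cinner e1 ((Z ** (P + dagger P)) *v e1))
      - 2 * Re (cinner e1 (P *v e1)) * Re (cinner e1 (Z *v e1))"
proof -
  let ?r = "Re (cinner e1 (Z *v e1))"
  \<comment> \<open>Passing to the adjoint conjugates the expectation in \<open>e1\<close>, which
    leaves its real part unchanged.\<close>
  have "Re (cinner e1 ((P ** dagger Z) *v e1)) = Re (cinner e1 ((Z ** dagger P) *v e1))"
    by (subst cinner_dagger) (simp add: dagger_mult cinner_eq_inner inner_commute)
  moreover have "Re (cinner e1 (P *v (lower_part Z *v e1))) =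
      Re (cinner e1 ((Z ** P) *v e1)) + Re (cinner e1 ((P ** dagger Z) *v e1))
        - ?r * Re (cinner e1 (P *v e1))"
    by (simp add: lower_part_e1 assms cinner_eq_inner algebra_simps inner_diff_right
        inner_add_right matrix_vector_mul_assoc mult_scaleR_vec)
  moreover have "Re (cinner e1 (lower_part Z *v (P *v e1))) = ?r * Re (cinner e1 (P *v e1))"
    by (subst cinner_dagger) (simp add: dagger_lower_part_e1 cinner_eq_inner)
  ultimately show ?thesis
    by (simp add: cinner_eq_inner inner_diff_right inner_add_right matrix_distribs
        matrix_vector_mult_diff_rdistrib matrix_vector_mult_add_rdistrib matrix_vector_mul_assoc)
qed

lemma bounded_linear_Re_e1:
  "bounded_linear (\<lambda>A :: 'n::{finite,linorder} cmat. Re (cinner e1 (A *v e1)))"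
proof -
  have "linear (\<lambda>A :: 'n cmat. Re (cinner e1 (A *v e1)))"
    by (rule linearI) (simp_all add: cinner_e1 mult_e1_nth)
  then show ?thesis
    by (simp add: linear_conv_bounded_linear)
qed

lemma matrix_poly_pderiv_commute:
  "(B ** matrix_poly (pderiv f) B) ** matrix_poly g B = matrix_poly g B ** (B ** matrix_poly (pderiv f) B)"
proof -
  let ?G = "matrix_poly g B" and ?F = "matrix_poly (pderiv f) B"
  have "B ** ?F ** ?G = B ** ?G ** ?F"
    using matrix_poly_commute_matrix[OF matrix_poly_commute[of B g], of "pderiv f"]
    by (simp flip: matrix_mul_assoc)
  then show ?thesis
    by (simp only: matrix_poly_commute[of B g] matrix_mul_assoc)
qed

text \<open>By \<open>comm\<close>, moving \<open>B\<close> in the direction of its commutator with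
  the lower part moves \<open>matrix_poly g B\<close> by its own commutator with that lower part, to
  which the formula at \<open>e1\<close> applies.\<close>

lemma poisson_spectral:
  "poisson (\<lambda>B. Im (trace (matrix_poly f B))) (\<lambda>B. Re (cinner e1 (matrix_poly g B *v e1))) B =
    Re (cinner e1 ((B ** matrix_poly (pderiv f) B ** (matrix_poly g B + dagger (matrix_poly g B))) *v e1))
      - 2 * Re (cinner e1 (matrix_poly g B *v e1)) * Re (cinner e1 ((B ** matrix_poly (pderiv f) B) *v e1))"
proof -
  obtain D where D: "((matrix_poly g) has_derivative D) (at B)"
    and comm: "\<And>R. D (B ** R - R ** B) = matrix_poly g B ** R - R ** matrix_poly g B"
    using matrix_poly_has_derivative by blast
  have "((\<lambda>A. Re (cinner e1 (matrix_poly g A *v e1))) has_derivative (\<lambda>C. Re (cinner e1 (D C *v e1)))) (at B)"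
    using bounded_linear_Re_e1 D by (rule bounded_linear.has_derivative)
  from poisson_eq_derivative[OF this grad_Im_trace_matrix_poly matrix_poly_commute[symmetric]]
  show ?thesis
    by (simp only: comm Re_cinner_commutator_lower_part[OF matrix_poly_pderiv_commute])
qed

subsection \<open>Smoothness of matrix polynomials\<close>

text \<open>Serves the product rule, in whose terms one factor stays undifferentiated.\<close>

lemma times_cont_diff_Suc_imp: "times_cont_diff (Suc k) f \<Longrightarrow> times_cont_diff k f"
proof (induction k arbitrary: f)
  case 0
  then obtain f' where "\<And>x. (f has_derivative f' x) (at x)"
    by auto
  then have "continuous (at x) f" for x
    by (rule has_derivative_continuous)
  then show ?case
    by (simp add: continuous_at_imp_continuous_on)
next
  case (Suc k)
  from Suc.prems obtain f' where f': "\<forall>x. (f has_derivative f' x) (at x)"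
    and "\<And>v. times_cont_diff (Suc k) (\<lambda>x. f' x v)"
    unfolding times_cont_diff.simps(2)[of "Suc k"] by blast
  then have "\<forall>v. times_cont_diff k (\<lambda>x. f' x v)"
    by (simp only: Suc.IH simp_thms)
  with f' show ?case
    unfolding times_cont_diff.simps(2)[of k] by (intro exI[of _ f'] conjI)
qed

lemma times_cont_diff_const: "times_cont_diff k (\<lambda>_. c)"
proof (induction k arbitrary: c)
  case (Suc k)
  then show ?case
    by (auto intro!: exI[of _ "\<lambda>_ _. 0"])
qed simp

lemma times_cont_diff_add:
  "times_cont_diff k f \<Longrightarrow> times_cont_diff k g \<Longrightarrow> times_cont_diff k (\<lambda>x. f x + g x)"
proof (induction k arbitrary: f g)
  case (Suc k)
  then obtain f' g' where f: "\<And>x. (f has_derivative f' x) (at x)"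
    "\<And>v. times_cont_diff k (\<lambda>x. f' x v)"
    and g: "\<And>x. (g has_derivative g' x) (at x)" "\<And>v. times_cont_diff k (\<lambda>x. g' x v)"
    by auto
  show ?case
    unfolding times_cont_diff.simps
    by (rule exI[of _ "\<lambda>x v. f' x v + g' x v"]) (simp add: has_derivative_add Suc.IH f g)
qed (simp add: continuous_on_add)

lemma times_cont_diff_mult:
  "times_cont_diff k f \<Longrightarrow> times_cont_diff k g \<Longrightarrow> times_cont_diff k (\<lambda>x. f x * g x)"
proof (induction k arbitrary: f g)
  case (Suc k)
  then obtain f' g' where f: "\<And>x. (f has_derivative f' x) (at x)"
    "\<And>v. times_cont_diff k (\<lambda>x. f' x v)"
    and g: "\<And>x. (g has_derivative g' x) (at x)" "\<And>v. times_cont_diff k (\<lambda>x. g' x v)"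
    by auto
  have "times_cont_diff k f" "times_cont_diff k g"
    by (rule times_cont_diff_Suc_imp, fact)+
  then show ?case
    unfolding times_cont_diff.simps
    by (intro exI[of _ "\<lambda>x v. f x * g' x v + f' x v * g x"])
      (simp add: has_derivative_mult times_cont_diff_add Suc.IH f g)
qed (simp add: continuous_on_mult)

lemma times_cont_diff_bounded_linear: "bounded_linear f \<Longrightarrow> times_cont_diff k f"
proof (cases k)
  case 0
  assume "bounded_linear f"
  then show ?thesis
    using 0 by (simp add: linear_continuous_on)
next
  case (Suc m)
  assume "bounded_linear f"
  then show ?thesis
    unfolding Suc times_cont_diff.simps
    by (intro exI[of _ "\<lambda>_. f"]) (auto simp: times_cont_diff_const bounded_linear_imp_has_derivative)
qed

lemma smooth_fun_const: "smooth_fun (\<lambda>_. c)"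
  by (simp add: smooth_fun_def times_cont_diff_const)

lemma smooth_fun_add: "smooth_fun f \<Longrightarrow> smooth_fun g \<Longrightarrow> smooth_fun (\<lambda>x. f x + g x)"
  by (simp add: smooth_fun_def times_cont_diff_add)

lemma smooth_fun_mult: "smooth_fun f \<Longrightarrow> smooth_fun g \<Longrightarrow> smooth_fun (\<lambda>x. f x * g x)"
  by (simp add: smooth_fun_def times_cont_diff_mult)

lemma smooth_fun_diff: "smooth_fun f \<Longrightarrow> smooth_fun g \<Longrightarrow> smooth_fun (\<lambda>x. f x - g x)"
  using smooth_fun_add[of f "\<lambda>x. - 1 * g x"] smooth_fun_mult[OF smooth_fun_const, of g "- 1"]
  by simp

lemma smooth_fun_sum: "(\<And>i. i \<in> S \<Longrightarrow> smooth_fun (f i)) \<Longrightarrow> smooth_fun (\<lambda>x. \<Sum>i\<in>S. f i x)"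
  by (induction S rule: infinite_finite_induct) (simp_all add: smooth_fun_const smooth_fun_add)

lemma smooth_fun_bounded_linear: "bounded_linear f \<Longrightarrow> smooth_fun f"
  by (simp add: smooth_fun_def times_cont_diff_bounded_linear)

text \<open>Flows are tested on real smooth functions only. Real and imaginary parts go through the
  induction together because complex multiplication mixes them.\<close>

lemma smooth_fun_matrix_poly:
  fixes i j :: "'n::finite"
  shows "smooth_fun (\<lambda>B. Re (matrix_poly p B $ i $ j)) \<and> smooth_fun (\<lambda>B. Im (matrix_poly p B $ i $ j))"
proof (induction p arbitrary: i j)
  case 0
  then show ?case by (simp add: smooth_fun_const)
next
  case (pCons a p)
  have "linear (\<lambda>B :: 'n cmat. Re (B $ i $ j))" "linear (\<lambda>B :: 'n cmat. Im (B $ i $ j))" for i j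
    by (auto intro: linearI)
  then have coord: "smooth_fun (\<lambda>B :: 'n cmat. Re (B $ i $ j))" "smooth_fun (\<lambda>B :: 'n cmat. Im (B $ i $ j))"
    for i j
    by (auto intro!: smooth_fun_bounded_linear simp: linear_conv_bounded_linear)
  have "matrix_poly (pCons a p) B $ i $ j = mat a $ i $ j + (\<Sum>k\<in>UNIV. B $ i $ k * matrix_poly p B $ k $ j)"
    for B :: "'n cmat"
    by (simp add: matrix_poly_pCons matrix_matrix_mult_def)
  then show ?case
    by (auto intro!: smooth_fun_add smooth_fun_const smooth_fun_sum smooth_fun_mult smooth_fun_diff
        simp: coord pCons)
qed

lemma smooth_fun_spectral:
  "smooth_fun (\<lambda>B :: 'n::{finite,linorder} cmat. Re (cinner e1 (matrix_poly g B *v e1)))"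
  by (simp add: cinner_e1 mult_e1_nth smooth_fun_matrix_poly)

subsection \<open>The Lax pair\<close>

text \<open>Testing the flow on the coordinate functionals, which are linear and hence smooth,
  recovers the motion of the matrix itself.\<close>

lemma flow_has_vector_derivative:
  assumes "hamiltonian_flow (\<lambda>B. Im (trace (matrix_poly f B))) T C" "t \<in> T"
  defines "L \<equiv> lower_part (C t ** matrix_poly (pderiv f) (C t))"
  shows "(C has_vector_derivative (C t ** L - L ** C t)) (at t)"
  unfolding has_vector_derivative_def has_derivative_componentwise_within[of C]
proof
  fix b :: "'a cmat"
  assume "b \<in> Basis"
  have lin: "bounded_linear (\<lambda>B. B \<bullet> b)"
    by (rule bounded_linear_inner_left)
  have "((\<lambda>s. C s \<bullet> b) has_real_derivative poisson (\<lambda>B. Im (trace (matrix_poly f B))) (\<lambda>B. B \<bullet> b) (C t)) (at t)"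
    using assms(1,2) smooth_fun_bounded_linear[OF lin] by (auto simp: hamiltonian_flow_def)
  also have "poisson (\<lambda>B. Im (trace (matrix_poly f B))) (\<lambda>B. B \<bullet> b) (C t) = (C t ** L - L ** C t) \<bullet> b"
    unfolding L_def
    by (intro poisson_eq_derivative bounded_linear_imp_has_derivative lin grad_Im_trace_matrix_poly
        matrix_poly_commute[symmetric])
  finally show "((\<lambda>s. C s \<bullet> b) has_derivative (\<lambda>x. (x *\<^sub>R (C t ** L - L ** C t)) \<bullet> b)) (at t)"
    by (simp add: has_field_derivative_def mult.commute[of _ "(C t ** L - L ** C t) \<bullet> b"])
qed

text \<open>\<open>?Z\<close> commutes with \<open>C t\<close>, so inside the commutator its lower
  part may be traded for minus its antihermitian part, the generator of an isometric motion.\<close>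

lemma flow_lax:
  assumes "hamiltonian_flow (\<lambda>B. Im (trace (matrix_poly f B))) T C" "t \<in> T"
  shows "\<exists>A\<in>antihermitian_matrices. (C has_vector_derivative (A ** C t - C t ** A)) (at t)"
proof
  let ?Z = "C t ** matrix_poly (pderiv f) (C t)"
  let ?A = "?Z - lower_part ?Z"
  have "C t ** ?Z = ?Z ** C t"
    using arg_cong[OF matrix_poly_commute[of "C t" "pderiv f"], of "(**) (C t)"]
    by (simp only: matrix_mul_assoc)
  then have "C t ** lower_part ?Z - lower_part ?Z ** C t = ?A ** C t - C t ** ?A"
    by (simp add: matrix_distribs)
  then show "(C has_vector_derivative (?A ** C t - C t ** ?A)) (at t)"
    using flow_has_vector_derivative[OF assms] by simp
qed (rule diff_lower_part_in)

section \<open>Properties conserved by the Lax equation\<close>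

lemma dagger_antihermitian: "A \<in> antihermitian_matrices \<Longrightarrow> dagger A = - A"
  unfolding antihermitian_matrices_def using equation_minus_iff[of A "dagger A"] by blast

lemma trace_minus: "trace (- A) = - trace (A :: 'n::finite cmat)"
  by (simp add: trace_def sum_negf)

text \<open>Infinitesimal form of the invariance of the Frobenius norm under unitary conjugation:
  each of the two traces equals minus its own conjugate, the second one by cyclicity.\<close>

lemma inner_commutator_antihermitian:
  assumes "A \<in> antihermitian_matrices"
  shows "D \<bullet> (A ** D - D ** A) = 0"
proof -
  have A: "dagger A = - A"
    using assms by (rule dagger_antihermitian)
  have "dagger (dagger D ** A ** D) = - (dagger D ** A ** D)"
    by (simp add: dagger_mult A matrix_distribs matrix_mul_assoc)
  then have "Re (trace (dagger D ** A ** D)) = 0"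
    using trace_dagger[of "dagger D ** A ** D"]
    by (simp add: trace_minus complex_eq_iff)
  moreover have "dagger (dagger D ** D ** A) = - (A ** (dagger D ** D))"
    by (simp add: dagger_mult A matrix_distribs)
  then have "Re (trace (dagger D ** D ** A)) = 0"
    using trace_dagger[of "dagger D ** D ** A"]
      trace_mul_sym[of A "dagger D ** D"]
    by (simp add: trace_minus complex_eq_iff)
  ultimately show ?thesis
    by (simp add: inner_eq_trace matrix_distribs matrix_mul_assoc trace_sub)
qed

text \<open>\<open>A\<close> may be chosen afresh at every time. The squared norm of
  \<open>D\<close> has derivative zero on the interval, so it keeps its value 0.\<close>

lemma lax_zero_preserved:
  fixes D :: "real \<Rightarrow> 'n::finite cmat"
  assumes "is_interval T"
    and lax: "\<And>t. t \<in> T \<Longrightarrow> \<exists>A\<in>antihermitian_matrices. (D has_vector_derivative (A ** D t - D t ** A)) (at t)"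
    and "t\<^sub>0 \<in> T" "D t\<^sub>0 = 0" "t \<in> T"
  shows "D t = 0"
proof -
  have "((\<lambda>s. D s \<bullet> D s) has_field_derivative 0) (at s within T)" if s: "s \<in> T" for s
  proof -
    from lax[OF s] obtain A where A: "A \<in> antihermitian_matrices"
      and D: "(D has_vector_derivative (A ** D s - D s ** A)) (at s)" by blast
    from bounded_bilinear.has_vector_derivative[OF bounded_bilinear_inner D D]
    have "((\<lambda>s. D s \<bullet> D s) has_vector_derivative 0) (at s)"
      by (simp add: inner_commutator_antihermitian[OF A] inner_commute[of _ "D s"])
    then show ?thesis
      by (simp add: has_real_derivative_iff_has_vector_derivative has_vector_derivative_at_within)
  qed
  then obtain c where "\<And>s. s \<in> T \<Longrightarrow> D s \<bullet> D s = c"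
    using has_field_derivative_zero_constant[of T "\<lambda>s. D s \<bullet> D s"] assms(1)
    by (metis is_interval_convex)
  from this[OF \<open>t \<in> T\<close>] this[OF \<open>t\<^sub>0 \<in> T\<close>] show ?thesis
    using \<open>D t\<^sub>0 = 0\<close> by simp
qed

text \<open>As \<open>A\<close> is antihermitian, \<open>dagger (C t)\<close> obeys the Lax equation
  with the same \<open>A\<close>; commutation with \<open>A\<close> is a derivation that kills
  \<open>mat 1\<close>.\<close>

lemma flow_preserves_unitary:
  assumes flow: "hamiltonian_flow (\<lambda>B. Im (trace (matrix_poly f B))) T C"
    and "is_interval T" "t\<^sub>0 \<in> T" "C t\<^sub>0 ** dagger (C t\<^sub>0) = mat 1" "t \<in> T"
  shows "C t ** dagger (C t) = mat 1"
proof -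
  let ?D = "\<lambda>t. C t ** dagger (C t) - mat 1"
  have "\<exists>A\<in>antihermitian_matrices. (?D has_vector_derivative (A ** ?D t - ?D t ** A)) (at t)"
    if t: "t \<in> T" for t
  proof -
    from flow_lax[OF flow t] obtain A where A: "A \<in> antihermitian_matrices"
      and C: "(C has_vector_derivative (A ** C t - C t ** A)) (at t)" by blast
    have [simp]: "dagger A = - A"
      using A by (rule dagger_antihermitian)
    from matrix_mult.has_vector_derivative[OF C bounded_linear.has_vector_derivative[OF bounded_linear_dagger C]]
    have "(?D has_vector_derivative (C t ** dagger (A ** C t - C t ** A)
        + (A ** C t - C t ** A) ** dagger (C t) - 0)) (at t)"
      by (rule has_vector_derivative_diff) (rule has_vector_derivative_const)
    also have "C t ** dagger (A ** C t - C t ** A) + (A ** C t - C t ** A) ** dagger (C t) - 0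
        = A ** ?D t - ?D t ** A"
      by (simp add: dagger_diff dagger_mult matrix_distribs matrix_mul_assoc)
    finally show ?thesis using A by blast
  qed
  from lax_zero_preserved[of T ?D, OF \<open>is_interval T\<close> this \<open>t\<^sub>0 \<in> T\<close> _ \<open>t \<in> T\<close>] show ?thesis
    using assms(4) by simp
qed

lemma flow_preserves_annihilator:
  assumes flow: "hamiltonian_flow (\<lambda>B. Im (trace (matrix_poly f B))) T C"
    and "is_interval T" "t\<^sub>0 \<in> T" "matrix_poly q (C t\<^sub>0) = 0" "t \<in> T"
  shows "matrix_poly q (C t) = 0"
proof -
  let ?D = "\<lambda>t. matrix_poly q (C t)"
  have "\<exists>A\<in>antihermitian_matrices. (?D has_vector_derivative (A ** ?D t - ?D t ** A)) (at t)"
    if t: "t \<in> T" for t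
  proof -
    from flow_lax[OF flow t] obtain A where A: "A \<in> antihermitian_matrices"
      and C: "(C has_vector_derivative (A ** C t - C t ** A)) (at t)" by blast
    obtain D where D: "((matrix_poly q) has_derivative D) (at (C t))"
      and comm: "\<And>R. D (C t ** R - R ** C t) = ?D t ** R - R ** ?D t"
      using matrix_poly_has_derivative by blast
    have "(?D has_derivative (\<lambda>h. D (h *\<^sub>R (A ** C t - C t ** A)))) (at t)"
      using has_derivative_compose[OF C[unfolded has_vector_derivative_def] D] .
    also have "(\<lambda>h. D (h *\<^sub>R (A ** C t - C t ** A))) = (\<lambda>h. h *\<^sub>R D (A ** C t - C t ** A))"
      using has_derivative_linear[OF D] by (simp add: linear_cmul)
    \<comment> \<open>\<open>comm\<close> has \<open>C t\<close> on the left of the commutator; the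
      choice \<open>- A\<close> corrects the sign.\<close>
    also have "D (A ** C t - C t ** A) = A ** ?D t - ?D t ** A"
      using comm[of "- A"] by (simp add: matrix_distribs)
    finally show ?thesis
      using A by (auto simp: has_vector_derivative_def)
  qed
  from lax_zero_preserved[of T ?D, OF \<open>is_interval T\<close> this \<open>t\<^sub>0 \<in> T\<close> _ \<open>t \<in> T\<close>] show ?thesis
    using assms(4) by simp
qed

subsection \<open>Functional calculus of unitary matrices\<close>

text \<open>For finite \<open>S\<close>, annihilation of a matrix by this polynomial encodes that
  the matrix is diagonalizable with all eigenvalues in \<open>S\<close>.\<close>

definition root_poly :: "complex set \<Rightarrow> complex poly" where
  "root_poly S = (\<Prod>z\<in>S. [:- z, 1:])"

text \<open>Keeps linear factors such as \<open>[:- a, 1:]\<close> from being multiplied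
  out.\<close>

declare mult_pCons_left [simp del] mult_pCons_right [simp del]

lemma root_poly_insert:
  "finite S \<Longrightarrow> a \<notin> S \<Longrightarrow> root_poly (insert a S) = [:- a, 1:] * root_poly S"
  unfolding root_poly_def by (rule prod.insert)

lemma poly_root_poly_eq_0_iff: "finite S \<Longrightarrow> poly (root_poly S) z = 0 \<longleftrightarrow> z \<in> S"
  by (auto simp: root_poly_def poly_prod)

lemma root_poly_dvd:
  assumes "finite S" "\<forall>z\<in>S. poly p z = 0"
  shows "root_poly S dvd p"
  using assms
proof (induction S arbitrary: p rule: finite_induct)
  case empty
  then show ?case by (simp add: root_poly_def)
next
  case (insert a S)
  then have "[:- a, 1:] dvd p"
    by (simp add: poly_eq_0_iff_dvd)
  then obtain q where q: "p = [:- a, 1:] * q" ..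
  have "\<forall>z\<in>S. poly q z = 0"
    using insert.prems insert.hyps(2) by (auto simp: q)
  then show ?case
    unfolding root_poly_insert[OF insert.hyps(1,2)] q by (intro mult_dvd_mono dvd_refl insert.IH)
qed

lemma interpolation:
  assumes "finite S"
  obtains p where "\<And>z. z \<in> S \<Longrightarrow> poly p z = (h z :: complex)"
proof -
  have "\<exists>p. \<forall>z\<in>S. poly p z = h z"
    using assms
  proof (induction S rule: finite_induct)
    case (insert a S)
    then obtain p where p: "\<forall>z\<in>S. poly p z = h z"
      by blast
    \<comment> \<open>Newton's step: the correction vanishes on \<open>S\<close>, and its
      denominator is nonzero because \<open>a\<close> lies outside \<open>S\<close>.\<close>
    let ?q = "p + smult ((h a - poly p a) / poly (root_poly S) a) (root_poly S)"
    have "\<forall>z\<in>insert a S. poly ?q z = h z"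
      using p insert.hyps poly_root_poly_eq_0_iff[of S] by auto
    then show ?case by blast
  qed simp
  then show ?thesis using that by blast
qed

text \<open>Only the values on \<open>S\<close> matter: \<open>p - q\<close> is a multiple of
  \<open>root_poly S\<close>, which annihilates \<open>A\<close>.\<close>

lemma matrix_poly_cong:
  assumes "finite S" "matrix_poly (root_poly S) A = 0" "\<And>z. z \<in> S \<Longrightarrow> poly p z = poly q z"
  shows "matrix_poly p A = matrix_poly q A"
proof -
  have "root_poly S dvd p - q"
    using assms by (intro root_poly_dvd) auto
  then obtain r where "p - q = root_poly S * r" ..
  then have "matrix_poly (p - q) A = 0"
    by (simp add: matrix_poly_mult assms(2))
  then show ?thesis by (simp add: matrix_poly_diff)
qed

text \<open>The Lagrange polynomials of \<open>S\<close> evaluated at \<open>A\<close> decompose every vector into eigenvectors.\<close>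
lemma matrix_eqI_eigenvectors:
  assumes S: "finite S" "matrix_poly (root_poly S) A = 0"
    and eq: "\<And>z v. A *v v = z *s v \<Longrightarrow> H *v v = K *v v"
  shows "H = (K :: 'n::finite cmat)"
proof -
  have "\<forall>z. \<exists>p. \<forall>w\<in>S. poly p w = (if w = z then 1 else 0)"
  proof
    fix z
    obtain p where "\<And>w. w \<in> S \<Longrightarrow> poly p w = (if w = z then 1 else 0)"
      using interpolation[OF S(1), of "\<lambda>w. if w = z then 1 else 0"] by blast
    then show "\<exists>p. \<forall>w\<in>S. poly p w = (if w = z then 1 else 0)"
      by blast
  qed
  from choice[OF this] obtain l
    where l: "\<And>z w. w \<in> S \<Longrightarrow> poly (l z) w = (if w = z then 1 else 0)"
    by blast
  \<comment> \<open>The Lagrange polynomials add up to 1 on \<open>S\<close>, which gives a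
    resolution of the identity.\<close>
  have "matrix_poly (\<Sum>z\<in>S. l z) A = matrix_poly 1 A"
    using S by (rule matrix_poly_cong) (simp add: poly_sum l S(1))
  then have sum_l: "(\<Sum>z\<in>S. matrix_poly (l z) A) = mat 1"
    by (simp add: matrix_poly_sum)
  have "(H - K) ** matrix_poly (l z) A = 0" for z
  proof -
    \<comment> \<open>This product vanishes on \<open>S\<close>, so the range of
      \<open>matrix_poly (l z) A\<close> lies in the eigenspace of \<open>z\<close>.\<close>
    have "matrix_poly ([:- z, 1:] * l z) A = matrix_poly 0 A"
      using S by (rule matrix_poly_cong) (simp add: l)
    then have "A ** matrix_poly (l z) A = mat z ** matrix_poly (l z) A"
      by (simp add: matrix_poly_mult matrix_poly_linear mat_minus matrix_distribs)
    then have "A *v (matrix_poly (l z) A *v v) = z *s (matrix_poly (l z) A *v v)" for v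
      by (simp only: matrix_vector_mul_assoc mat_mult_vec[symmetric])
    from eq[OF this] have "H ** matrix_poly (l z) A = K ** matrix_poly (l z) A"
      by (simp only: matrix_eq matrix_vector_mul_assoc) simp
    then show ?thesis by (simp add: matrix_distribs)
  qed
  then have "(H - K) ** (\<Sum>z\<in>S. matrix_poly (l z) A) = 0"
    by (simp add: matrix_mult.sum_right)
  then show ?thesis by (simp add: sum_l)
qed

lemma eigenvalue_in_roots:
  assumes "finite S" "matrix_poly (root_poly S) A = 0" "A *v v = z *s v" "v \<noteq> 0"
  shows "z \<in> S"
  using matrix_poly_eigenvector[OF assms(3), of "root_poly S"] assms
  by (simp add: poly_root_poly_eq_0_iff)

text \<open>Eigenvectors span the space here, so the description in \<open>matrix_fun\<close> is
  unique. Restricting \<open>H\<close> to nonzero \<open>v\<close> makes \<open>z\<close> a genuine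
  eigenvalue, hence a point of \<open>S\<close>.\<close>

lemma matrix_fun_eqI:
  assumes S: "finite S" "matrix_poly (root_poly S) A = 0"
    and H: "\<And>z v. v \<noteq> 0 \<Longrightarrow> A *v v = z *s v \<Longrightarrow> H *v v = h z *s v"
  shows "matrix_fun h A = H"
  unfolding matrix_fun_def
proof (rule the_equality)
  have "A *v v = z *s v \<Longrightarrow> H *v v = h z *s v" for z v
    using H[of v z] by (cases "v = 0") auto
  then show *: "\<forall>z v. A *v v = z *s v \<longrightarrow> H *v v = h z *s v"
    by blast
  fix K
  assume "\<forall>z v. A *v v = z *s v \<longrightarrow> K *v v = h z *s v"
  with * show "K = H"
    by (intro matrix_eqI_eigenvectors[OF S]) metis
qed

section \<open>Annihilating polynomials with simple roots\<close>

lemma matrix_poly_annihilator_exists: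
  fixes A :: "'n::finite cmat"
  obtains p where "p \<noteq> 0" "matrix_poly p A = 0"
\<comment> \<open>Two equal powers already give an annihilator. Otherwise there are more powers than
  the real dimension, and a real linear relation between them gives one.\<close>
proof (cases "inj_on (\<lambda>k. matrix_poly (monom 1 k) A) {..DIM('n cmat)}")
  case False
  then obtain i j where "i \<noteq> j" "matrix_poly (monom 1 i) A = matrix_poly (monom 1 j) A"
    by (auto simp: inj_on_def)
  moreover have "monom (1::complex) i - monom 1 j \<noteq> 0"
    using \<open>i \<noteq> j\<close> by (simp add: monom_eq_iff')
  ultimately show ?thesis
    using that[of "monom 1 i - monom 1 j"] by (simp add: matrix_poly_diff)
next
  case True
  let ?I = "{..DIM('n cmat)}" and ?P = "\<lambda>k. matrix_poly (monom 1 k) A"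
  have "dependent (?P ` ?I)"
    using card_image[OF True] by (intro dependent_biggerset) auto
  then obtain u where u: "\<exists>v\<in>?P ` ?I. u v \<noteq> 0" "(\<Sum>v\<in>?P ` ?I. u v *\<^sub>R v) = 0"
    by (auto simp: dependent_finite)
  let ?c = "\<lambda>k. complex_of_real (u (?P k))"
  let ?p = "\<Sum>k\<in>?I. monom (?c k) k"
  have coeff: "coeff ?p k = ?c k" if "k \<in> ?I" for k
    using that by (simp add: coeff_sum)
  from u(1) obtain k where k: "k \<in> ?I" "u (?P k) \<noteq> 0"
    by blast
  then have "coeff ?p k \<noteq> 0"
    using coeff[OF k(1)] by simp
  then have "?p \<noteq> 0"
    by auto
  have "matrix_poly ?p A = (\<Sum>k\<in>?I. u (?P k) *\<^sub>R ?P k)"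
  proof -
    have "matrix_poly (monom (complex_of_real r) k) A = r *\<^sub>R ?P k" for r k
    proof -
      have "matrix_poly (monom (complex_of_real r) k) A = mat (of_real r) ** ?P k"
        using matrix_poly_smult[of "of_real r" "monom 1 k" A] by (simp add: smult_monom)
      then show ?thesis
        by (simp add: vec_eq_iff mat_mult_nth scaleR_conv_of_real[where 'a = complex])
    qed
    then show ?thesis by (simp add: matrix_poly_sum)
  qed
  also have "\<dots> = 0"
    using u(2) unfolding sum.reindex[OF True] comp_def .
  finally show ?thesis
    by (rule that[OF \<open>?p \<noteq> 0\<close>])
qed

text \<open>A normal \<open>N\<close> and its adjoint have the same kernel, so the kernels of
  \<open>N ** N\<close> and \<open>N\<close> agree; \<open>M\<close> collects the vectors as
  columns.\<close>

lemma normal_square_mult_eq_0: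
  fixes N M :: "'n::finite cmat"
  assumes normal: "dagger N ** N = N ** dagger N" and "N ** (N ** M) = 0"
  shows "N ** M = 0"
proof -
  define K where "K = N ** M"
  have "N ** K = 0"
    using assms(2) by (simp add: K_def)
  have "dagger (dagger N ** K) ** (dagger N ** K) = dagger K ** (N ** dagger N) ** K"
    by (simp add: dagger_mult matrix_mul_assoc)
  also have "\<dots> = dagger K ** dagger N ** (N ** K)"
    by (simp add: normal[symmetric] matrix_mul_assoc)
  also have "\<dots> = 0"
    by (simp add: \<open>N ** K = 0\<close>)
  finally have "dagger N ** K = 0"
    by (rule dagger_mult_self_eq_0)
  moreover have "dagger K ** K = dagger M ** (dagger N ** K)"
    by (simp add: K_def dagger_mult matrix_mul_assoc)
  ultimately have "dagger K ** K = 0"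
    by simp
  then show ?thesis
    unfolding K_def[symmetric] by (rule dagger_mult_self_eq_0)
qed

lemma normal_diff_mat:
  assumes "dagger A ** A = A ** dagger A"
  shows "dagger (mat a + A) ** (mat a + A) = (mat a + A) ** dagger (mat a + A)"
  by (simp add: dagger_add dagger_mat matrix_distribs assms mat_mat mult.commute
      mat_mult_commute[of "cnj a" A] mat_mult_commute[of a "dagger A"])

text \<open>Normality lets repeated roots of an annihilating polynomial be discarded one at a time.\<close>
lemma normal_root_poly:
  fixes A M :: "'n::finite cmat"
  assumes normal: "dagger A ** A = A ** dagger A"
  shows "p \<noteq> 0 \<Longrightarrow> matrix_poly p A ** M = 0 \<Longrightarrow>
    \<exists>S. finite S \<and> matrix_poly (root_poly S) A ** M = 0"
proof (induction "degree p" arbitrary: p M rule: less_induct)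
  case less
  show ?case
  proof (cases "degree p = 0")
    case True
    then obtain c where c: "p = [:c:]" "c \<noteq> 0"
      using less.prems(1) by (auto elim: degree_eq_zeroE)
    then have "mat c ** M = 0"
      using less.prems(2) by (simp add: matrix_poly_pCons)
    then have "M = 0"
      using c(2) by (simp add: vec_eq_iff mat_mult_nth)
    then show ?thesis
      by (intro exI[of _ "{}"]) simp
  next
    case False
    then obtain a where "poly p a = 0"
      using fundamental_theorem_of_algebra[of p] by (auto simp: constant_degree)
    then have "[:- a, 1:] dvd p"
      by (simp add: poly_eq_0_iff_dvd)
    then obtain q where q: "p = [:- a, 1:] * q" ..
    then have "q \<noteq> 0"
      using less.prems(1) by auto
    then have "degree q < degree p"
      unfolding q by (subst degree_mult_eq) auto
    define N where "N = mat (- a) + A"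
    have N: "matrix_poly [:- a, 1:] A = N"
      by (simp add: N_def matrix_poly_linear)
    have comm: "matrix_poly r A ** (N ** X) = N ** (matrix_poly r A ** X)" for r X
      using arg_cong[of "[:- a, 1:] * r" "r * [:- a, 1:]" "\<lambda>p. matrix_poly p A ** X"]
      by (simp add: matrix_poly_mult N matrix_mul_assoc)
    \<comment> \<open>The split-off factor \<open>N\<close> is absorbed into \<open>M\<close>; the
      arbitrary right factor in the statement makes the induction hypothesis fit.\<close>
    have "matrix_poly q A ** (N ** M) = 0"
      using less.prems(2) by (simp add: q matrix_poly_mult N comm) (simp add: matrix_mul_assoc)
    from less.hyps[OF \<open>degree q < degree p\<close> \<open>q \<noteq> 0\<close> this]
    obtain S where S: "finite S" "matrix_poly (root_poly S) A ** (N ** M) = 0"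
      by blast
    show ?thesis
    proof (cases "a \<in> S")
      case False
      then show ?thesis
        using S by (intro exI[of _ "insert a S"])
          (simp add: root_poly_insert matrix_poly_mult N comm flip: matrix_mul_assoc)
    next
      \<comment> \<open>The root is already present, so \<open>N\<close> occurs twice; normality
        removes one copy.\<close>
      case True
      define Q where "Q = matrix_poly (root_poly (S - {a})) A"
      have "root_poly S = [:- a, 1:] * root_poly (S - {a})"
        using root_poly_insert[of "S - {a}" a] S(1) True by (simp add: insert_absorb)
      then have Q: "matrix_poly (root_poly S) A = N ** Q"
        by (simp add: matrix_poly_mult N Q_def)
      have "N ** (N ** (Q ** M)) = 0"
        using S(2) comm[of "root_poly (S - {a})" M] by (simp add: Q Q_def flip: matrix_mul_assoc)
      then have "N ** (Q ** M) = 0"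
        using normal_square_mult_eq_0[OF normal_diff_mat[OF normal]] by (simp add: N_def)
      then show ?thesis
        using S(1) by (intro exI[of _ S]) (simp add: Q flip: matrix_mul_assoc)
    qed
  qed
qed

lemma unitary_root_poly:
  fixes A :: "'n::finite cmat"
  assumes "A ** dagger A = mat 1"
  obtains S where "finite S" "matrix_poly (root_poly S) A = 0"
proof -
  obtain p where "p \<noteq> 0" "matrix_poly p A ** mat 1 = 0"
    using matrix_poly_annihilator_exists by (metis matrix_mul_rid)
  moreover have "dagger A ** A = A ** dagger A"
    using assms matrix_left_right_inverse[of A "dagger A"] by simp
  ultimately show ?thesis
    using normal_root_poly that by (metis matrix_mul_rid)
qed

subsection \<open>Eigenvectors of unitary matrices\<close>

lemma cinner_smult: "cinner (a *s u) (b *s v) = cnj a * b * cinner u v"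
  by (simp add: cinner_def sum_distrib_left mult_ac)

text \<open>Invariance of the norm gives |z| = 1, and applying the adjoint to the eigenvalue
  equation gives \<open>v = z *s (dagger A *v v)\<close>, which is then multiplied by
  \<open>cnj z\<close>.\<close>

lemma unitary_eigenvector:
  assumes "A ** dagger A = mat 1" "A *v v = z *s v" "v \<noteq> 0"
  shows "dagger A *v v = cnj z *s v"
proof -
  have inv: "dagger A ** A = mat 1"
    using assms(1) matrix_left_right_inverse[of A "dagger A"] by simp
  have "cinner (A *v v) (A *v v) = cinner v v"
    by (simp add: cinner_dagger[of "A *v v"] matrix_vector_mul_assoc inv)
  then have "cnj z * z * cinner v v = cinner v v"
    by (simp add: assms(2) cinner_smult)
  moreover have "cinner v v \<noteq> 0"
    using cinner_eq_inner[of v v] assms(3) by (metis inner_eq_zero_iff zero_complex.sel(1))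
  ultimately have z: "cnj z * z = 1"
    by simp
  have "v = z *s (dagger A *v v)"
    using arg_cong[OF assms(2), of "(*v) (dagger A)"]
    by (simp add: matrix_vector_mul_assoc inv mult_smult_vec)
  then have "cnj z *s v = cnj z *s (z *s (dagger A *v v))"
    by simp
  then show ?thesis
    by (simp add: z)
qed

lemma dagger_matrix_poly_eigenvector:
  assumes "dagger A *v v = cnj z *s v"
  shows "dagger (matrix_poly p A) *v v = cnj (poly p z) *s v"
proof (induction p)
  case (pCons a p)
  have "dagger (matrix_poly p A) *v (dagger A *v v) = (cnj z * cnj (poly p z)) *s v"
    by (simp add: pCons mult_smult_vec assms mult.commute)
  then show ?case
    by (simp add: matrix_poly_pCons dagger_add dagger_mat dagger_mult matrix_vector_mult_add_rdistrib
        mat_mult_vec vec.scale_left_distrib flip: matrix_vector_mul_assoc)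
qed simp

subsection \<open>Integrals against the spectral measure\<close>

text \<open>Reduces an integral to exhibiting a matrix with the right eigenvalues on the
  eigenvectors of \<open>A\<close>.\<close>

lemma spectral_integral:
  fixes h :: "complex \<Rightarrow> real"
  assumes "is_spectral_measure A v \<mu>" and S: "finite S" "matrix_poly (root_poly S) A = 0"
    and H: "\<And>z u. u \<noteq> 0 \<Longrightarrow> A *v u = z *s u \<Longrightarrow> H *v u = of_real (h z) *s u"
  shows "(\<integral>z. h z \<partial>\<mu>) = Re (cinner v (H *v v))"
proof -
  have "matrix_fun (\<lambda>z. of_real (h z)) A = H"
    using matrix_fun_eqI[OF S, of H "\<lambda>z. of_real (h z)"] H by blast
  then have "cinner v (H *v v) = (\<integral>z. of_real (h z) \<partial>\<mu>)"
    using assms(1) unfolding is_spectral_measure_def by metis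
  then show ?thesis by simp
qed

lemma flow_spectral_derivative:
  assumes "hamiltonian_flow (\<lambda>B. Im (trace (matrix_poly f B))) T C" "t \<in> T"
  shows "((\<lambda>s. Re (cinner e1 (matrix_poly g (C s) *v e1))) has_real_derivative
    Re (cinner e1 ((C t ** matrix_poly (pderiv f) (C t) **
        (matrix_poly g (C t) + dagger (matrix_poly g (C t)))) *v e1))
      - 2 * Re (cinner e1 (matrix_poly g (C t) *v e1))
        * Re (cinner e1 ((C t ** matrix_poly (pderiv f) (C t)) *v e1))) (at t)"
proof -
  let ?\<psi> = "\<lambda>B :: 'a cmat. Re (cinner e1 (matrix_poly g B *v e1))"
  have "smooth_fun ?\<psi> \<longrightarrow> ((\<lambda>s. ?\<psi> (C s)) has_real_derivative
      poisson (\<lambda>B. Im (trace (matrix_poly f B))) ?\<psi> (C t)) (at t)"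
    using assms unfolding hamiltonian_flow_def by blast
  from mp[OF this smooth_fun_spectral] show ?thesis
    unfolding poisson_spectral .
qed

lemma spectral_measure_derivative:
  fixes f :: "complex poly" and C :: "real \<Rightarrow> 'n::{finite,linorder} cmat" and G :: "complex \<Rightarrow> real"
  assumes "open T" "is_interval T" and flow: "hamiltonian_flow (\<lambda>B. Im (trace (matrix_poly f B))) T C"
    and "t\<^sub>0 \<in> T" and U\<^sub>0: "C t\<^sub>0 ** dagger (C t\<^sub>0) = mat 1"
    and \<mu>: "\<And>t. t \<in> T \<Longrightarrow> is_spectral_measure (C t) e1 (\<mu> t)" and "t \<in> T"
  defines "F \<equiv> \<lambda>z. 2 * Re (z * poly (pderiv f) z)"
  shows "((\<lambda>s. \<integral>z. G z \<partial>\<mu> s) has_real_derivative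
    (\<integral>z. F z * G z \<partial>\<mu> t) - (\<integral>z. F z \<partial>\<mu> t) * (\<integral>z. G z \<partial>\<mu> t)) (at t)"
proof -
  have U: "C s ** dagger (C s) = mat 1" if "s \<in> T" for s
    using flow_preserves_unitary[OF flow \<open>is_interval T\<close> \<open>t\<^sub>0 \<in> T\<close> U\<^sub>0 that] .
  obtain S where S: "finite S" and S\<^sub>0: "matrix_poly (root_poly S) (C t\<^sub>0) = 0"
    using unitary_root_poly[OF U\<^sub>0] by blast
  have SC: "matrix_poly (root_poly S) (C s) = 0" if "s \<in> T" for s
    using flow_preserves_annihilator[OF flow \<open>is_interval T\<close> \<open>t\<^sub>0 \<in> T\<close> S\<^sub>0 that] .
  \<comment> \<open>\<open>S\<close> stems from time \<open>t\<^sub>0\<close> but annihilates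
    \<open>C s\<close> throughout \<open>T\<close>, so \<open>g\<close> is independent of
    \<open>s\<close> and the polynomial formula can be differentiated.\<close>
  obtain g where g: "\<And>z. z \<in> S \<Longrightarrow> poly g z = of_real (G z)"
    using interpolation[OF S, of "\<lambda>z. of_real (G z)"] by blast
  let ?g = "\<lambda>s. matrix_poly g (C s)" and ?Z = "C t ** matrix_poly (pderiv f) (C t)"
  have G_eig: "?g s *v v = of_real (G z) *s v" if "s \<in> T" "v \<noteq> 0" "C s *v v = z *s v" for s z v
    using matrix_poly_eigenvector[OF that(3), of g] g eigenvalue_in_roots[OF S SC[OF that(1)] that(3,2)]
    by simp
  have int_G: "(\<integral>z. G z \<partial>\<mu> s) = Re (cinner e1 (?g s *v e1))" if "s \<in> T" for s
    using spectral_integral[OF \<mu>[OF that] S SC[OF that]] G_eig[OF that] by blast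
  have Z_poly: "?Z = matrix_poly (pCons 0 (pderiv f)) (C t)"
    by (simp add: matrix_poly_pCons)
  \<comment> \<open>A function of a unitary matrix with real values on the spectrum is
    hermitian.\<close>
  have dagger_g: "dagger (?g t) = ?g t"
  proof (rule matrix_eqI_eigenvectors[OF S SC[OF \<open>t \<in> T\<close>]])
    fix z v
    assume v: "C t *v v = z *s v"
    show "dagger (?g t) *v v = ?g t *v v"
    proof (cases "v = 0")
      case False
      have "dagger (?g t) *v v = cnj (poly g z) *s v"
        using unitary_eigenvector[OF U[OF \<open>t \<in> T\<close>] v False] by (rule dagger_matrix_poly_eigenvector)
      then show ?thesis
        using g eigenvalue_in_roots[OF S SC[OF \<open>t \<in> T\<close>] v False] G_eig[OF \<open>t \<in> T\<close> False v]
        by simp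
    qed simp
  qed
  have F_eig: "(?Z + dagger ?Z) *v v = of_real (F z) *s v" if "v \<noteq> 0" "C t *v v = z *s v" for z v
  proof -
    have "?Z *v v = (z * poly (pderiv f) z) *s v"
      using matrix_poly_eigenvector[OF that(2), of "pCons 0 (pderiv f)"] by (simp add: Z_poly)
    moreover have "dagger ?Z *v v = cnj (z * poly (pderiv f) z) *s v"
      using dagger_matrix_poly_eigenvector[OF unitary_eigenvector[OF U[OF \<open>t \<in> T\<close>] that(2,1)],
          of "pCons 0 (pderiv f)"] by (simp add: Z_poly)
    moreover have "z * poly (pderiv f) z + cnj (z * poly (pderiv f) z) = of_real (F z)"
      by (simp add: F_def complex_add_cnj del: complex_cnj_mult)
    ultimately show ?thesis
      by (simp add: matrix_vector_mult_add_rdistrib flip: vec.scale_left_distrib)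
  qed
  have "(\<integral>z. F z \<partial>\<mu> t) = Re (cinner e1 ((?Z + dagger ?Z) *v e1))"
    using spectral_integral[OF \<mu>[OF \<open>t \<in> T\<close>] S SC[OF \<open>t \<in> T\<close>]] F_eig by blast
  also have "\<dots> = 2 * Re (cinner e1 (?Z *v e1))"
    using arg_cong[OF cinner_dagger[of e1 ?Z e1], of Re]
    by (simp add: matrix_vector_mult_add_rdistrib cinner_eq_inner inner_add_right inner_commute)
  finally have int_F: "(\<integral>z. F z \<partial>\<mu> t) = 2 * Re (cinner e1 (?Z *v e1))" .
  have "((?Z + dagger ?Z) ** ?g t) *v v = of_real (F z * G z) *s v"
    if "v \<noteq> 0" "C t *v v = z *s v" for z v
    by (simp add: G_eig[OF \<open>t \<in> T\<close> that] F_eig[OF that] mult_smult_vec mult.commute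
        flip: matrix_vector_mul_assoc)
  then have "(\<integral>z. F z * G z \<partial>\<mu> t) = Re (cinner e1 (((?Z + dagger ?Z) ** ?g t) *v e1))"
    using spectral_integral[OF \<mu>[OF \<open>t \<in> T\<close>] S SC[OF \<open>t \<in> T\<close>], of "(?Z + dagger ?Z) ** ?g t" "\<lambda>z. F z * G z"]
    by blast
  also have "\<dots> = Re (cinner e1 ((?Z ** ?g t) *v e1)) + Re (cinner e1 ((dagger ?Z ** ?g t) *v e1))"
    by (simp add: matrix_distribs matrix_vector_mult_add_rdistrib cinner_eq_inner inner_add_right)
  also have "Re (cinner e1 ((dagger ?Z ** ?g t) *v e1)) = Re (cinner e1 ((?g t ** ?Z) *v e1))"
    by (subst cinner_dagger) (simp add: dagger_mult dagger_g cinner_eq_inner inner_commute)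
  also have "?g t ** ?Z = ?Z ** ?g t"
    by (rule matrix_poly_pderiv_commute[symmetric])
  \<comment> \<open>Both halves of \<open>?Z + dagger ?Z\<close> contribute the same real part; as
    \<open>?g t\<close> is hermitian, their sum takes the form of the first term of the
    bracket.\<close>
  finally have int_FG: "(\<integral>z. F z * G z \<partial>\<mu> t) = Re (cinner e1 ((?Z ** (?g t + dagger (?g t))) *v e1))"
    by (simp only: dagger_g matrix_distribs matrix_vector_mult_add_rdistrib cinner_eq_inner inner_add_right)
  have "((\<lambda>s. Re (cinner e1 (?g s *v e1))) has_real_derivative
      (\<integral>z. F z * G z \<partial>\<mu> t) - (\<integral>z. F z \<partial>\<mu> t) * (\<integral>z. G z \<partial>\<mu> t)) (at t)"
    using flow_spectral_derivative[OF flow \<open>t \<in> T\<close>, of g]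
    unfolding int_FG int_F int_G[OF \<open>t \<in> T\<close>] by (simp only: mult_ac)
  \<comment> \<open>\<open>int_G\<close> identifies the two functions on \<open>T\<close> only;
    openness of \<open>T\<close> transfers the derivative.\<close>
  then show ?thesis
    using \<open>open T\<close> \<open>t \<in> T\<close> by (rule has_field_derivative_transform_within_open) (simp add: int_G)
qed

subsection \<open>CMV matrices are unitary\<close>

text \<open>\<open>idx\<close> is strictly increasing, hence injective, and counting gives its
  range. Row sums thus become sums over natural numbers, where blocks are found by division by
  2.\<close>

lemma bij_betw_idx: "bij_betw (idx :: 'n::{finite,linorder} \<Rightarrow> nat) UNIV {..<CARD('n)}"
proof -
  have less: "idx i < idx j" if "i < j" for i j :: 'n
    unfolding idx_def using that by (intro psubset_card_mono) auto
  then have inj: "inj (idx :: 'n \<Rightarrow> nat)"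
    by (metis injI less_irrefl linorder_less_linear)
  have "idx i < CARD('n)" for i :: 'n
    unfolding idx_def by (intro psubset_card_mono) auto
  then have "range (idx :: 'n \<Rightarrow> nat) \<subseteq> {..<CARD('n)}"
    by auto
  moreover have "card (range (idx :: 'n \<Rightarrow> nat)) = card {..<CARD('n)}"
    using inj by (simp add: card_image)
  ultimately have "range (idx :: 'n \<Rightarrow> nat) = {..<CARD('n)}"
    by (intro card_subset_eq) auto
  then show ?thesis
    using inj by (simp add: bij_betw_def)
qed

lemma idx_less: "idx (i :: 'n::{finite,linorder}) < CARD('n)"
  using bij_betw_idx[where 'n = 'n] by (auto simp: bij_betw_def)

lemma idx_eq_iff: "idx i = idx j \<longleftrightarrow> i = j"
  using bij_betw_idx by (auto simp: bij_betw_def inj_def)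

lemma unitaryI_idx:
  fixes A :: "'n::{finite,linorder} cmat"
  assumes A: "\<And>i j. A $ i $ j = K (idx i) (idx j)"
    and K: "\<And>p q. p < CARD('n) \<Longrightarrow> q < CARD('n) \<Longrightarrow>
      (\<Sum>m<CARD('n). K p m * cnj (K q m)) = (if p = q then 1 else 0)"
  shows "A ** dagger A = mat 1"
proof -
  have "(\<Sum>k\<in>UNIV. K p (idx (k :: 'n)) * cnj (K q (idx k))) = (\<Sum>m<CARD('n). K p m * cnj (K q m))" for p q
    by (rule sum.reindex_bij_betw[OF bij_betw_idx])
  then show ?thesis
    by (simp add: vec_eq_iff matrix_matrix_mult_def A K idx_less idx_eq_iff mat_def)
qed

text \<open>Position \<open>p\<close> of the matrix is position \<open>p + s\<close> of the sequence of \<open>2 \<times> 2\<close> blocks, numbered by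
  \<open>b\<close>; a shift \<open>s = 1\<close> cuts the first block down to its last entry, as in \<open>\<M>\<close>.\<close>
lemma block_unitary:
  fixes X :: "nat \<Rightarrow> nat \<Rightarrow> nat \<Rightarrow> complex"
  assumes K: "\<And>p q. K p q =
      (if (p + s) div 2 = (q + s) div 2 then X ((p + s) div 2) ((p + s) mod 2) ((q + s) mod 2) else 0)"
    and two: "\<And>b a c. s \<le> 2 * b \<Longrightarrow> 2 * b + 1 < n + s \<Longrightarrow> a < 2 \<Longrightarrow> c < 2 \<Longrightarrow>
      X b a 0 * cnj (X b c 0) + X b a 1 * cnj (X b c 1) = (if a = c then 1 else 0)"
    and first: "s = 1 \<Longrightarrow> X 0 1 1 * cnj (X 0 1 1) = 1"
    and last: "\<And>b. 2 * b + 1 = n + s \<Longrightarrow> X b 0 0 * cnj (X b 0 0) = 1"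
    and "s \<le> 1" "p < n" "q < n"
  shows "(\<Sum>m<n. K p m * cnj (K q m)) = (if p = q then 1 else 0)"
proof -
  define b where "b = (p + s) div 2"
  have "(\<Sum>m<n. K p m * cnj (K q m)) = (\<Sum>m\<in>{m\<in>{..<n}. (m + s) div 2 = b}. K p m * cnj (K q m))"
    by (rule sum.mono_neutral_right) (auto simp: K b_def)
  also have "\<dots> = (\<Sum>m\<in>{m\<in>{s..<n + s}. m div 2 = b}. K p (m - s) * cnj (K q (m - s)))"
    by (rule sum.reindex_bij_witness[of _ "\<lambda>m. m - s" "\<lambda>m. m + s"]) auto
  also have "\<dots> = (if p = q then 1 else 0)"
  proof (cases "(q + s) div 2 = b")
    case False
    then have "p \<noteq> q"
      by (auto simp: b_def)
    with False show ?thesis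
      by (auto intro!: sum.neutral simp: K)
  next
    case q: True
    have sum: "(\<Sum>m\<in>M. K p (m - s) * cnj (K q (m - s))) =
        (\<Sum>m\<in>M. X b ((p + s) mod 2) (m mod 2) * cnj (X b ((q + s) mod 2) (m mod 2)))"
      if "M \<subseteq> {m. s \<le> m \<and> m div 2 = b}" for M
    proof (intro sum.cong refl)
      fix m
      assume "m \<in> M"
      then have m: "m - s + s = m" "m div 2 = b"
        using that by auto
      show "K p (m - s) * cnj (K q (m - s)) =
          X b ((p + s) mod 2) (m mod 2) * cnj (X b ((q + s) mod 2) (m mod 2))"
        by (simp only: K m q b_def[symmetric] refl if_True)
    qed
    have eq: "p = q \<longleftrightarrow> (p + s) mod 2 = (q + s) mod 2"
      using q unfolding b_def by (metis add_right_cancel div_mult_mod_eq)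
    \<comment> \<open>The block of \<open>p\<close> is either cut at the start, cut at the end, or a
      full 2 by 2 block.\<close>
    consider "s = 1" "b = 0" | "2 * b + 1 = n + s" | "s \<le> 2 * b" "2 * b + 1 < n + s"
      using \<open>s \<le> 1\<close> \<open>p < n\<close> unfolding b_def by linarith
    then show ?thesis
    proof cases
      case 1
      then have "{m\<in>{s..<n + s}. m div 2 = b} = {1}" "p = 0" "q = 0"
        using \<open>p < n\<close> q by (auto simp: b_def)
      then show ?thesis
        using sum[of "{1}"] 1 first by simp
    next
      case 2
      have "p + s = 2 * b" "q + s = 2 * b"
        using 2 q \<open>p < n\<close> \<open>q < n\<close> unfolding b_def by linarith+
      moreover from this have "{m\<in>{s..<n + s}. m div 2 = b} = {2 * b}"
        using 2 by auto
      ultimately show ?thesis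
        using sum[of "{2 * b}"] last[OF 2] eq by auto
    next
      case 3
      then have "{m\<in>{s..<n + s}. m div 2 = b} = {2 * b, 2 * b + 1}"
        by auto
      moreover have "{2 * b, 2 * b + 1} \<subseteq> {m. s \<le> m \<and> m div 2 = b}"
        using 3 by auto
      ultimately show ?thesis
        using sum[of "{2 * b, 2 * b + 1}"] two[OF 3, of "(p + s) mod 2" "(q + s) mod 2"] eq by simp
    qed
  qed
  finally show ?thesis .
qed

text \<open>The rows have length one because the squared off-diagonal entry is 1 - |alpha|^2, and
  the sign of \<open>- \<alpha> k\<close> makes them orthogonal. The bound on \<open>k\<close>
  excludes the 1 by 1 block.\<close>

lemma Xi_unitary:
  assumes "k < n - 1" "cmod (\<alpha> k) < 1" "a < 2" "c < 2"
  shows "Xi n \<alpha> k a 0 * cnj (Xi n \<alpha> k c 0) + Xi n \<alpha> k a 1 * cnj (Xi n \<alpha> k c 1) = (if a = c then 1 else 0)"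
proof -
  define r where "r = sqrt (1 - (cmod (\<alpha> k))\<^sup>2)"
  have "(cmod (\<alpha> k))\<^sup>2 \<le> 1"
    using assms(2) by (simp add: power_le_one)
  then have "r\<^sup>2 = 1 - (cmod (\<alpha> k))\<^sup>2"
    by (simp add: r_def)
  moreover have "\<alpha> k * cnj (\<alpha> k) = of_real ((cmod (\<alpha> k))\<^sup>2)"
    by (rule complex_norm_square[symmetric])
  ultimately have r: "of_real r * of_real r = 1 - \<alpha> k * cnj (\<alpha> k)"
    by (metis of_real_1 of_real_diff of_real_mult power2_eq_square)
  have "Xi n \<alpha> k 0 0 = cnj (\<alpha> k)" "Xi n \<alpha> k 1 1 = - \<alpha> k" "Xi n \<alpha> k 0 1 = of_real r" "Xi n \<alpha> k 1 0 = of_real r"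
    using assms(1) by (simp_all add: Xi_def r_def)
  moreover have "a = 0 \<or> a = 1" "c = 0 \<or> c = 1"
    using assms(3,4) by auto
  ultimately show ?thesis
    by (auto simp: r mult.commute)
qed

lemma cmv_L_unitary:
  assumes "\<forall>k < CARD('n) - 1. cmod (\<alpha> k) < 1" "cmod (\<alpha> (CARD('n) - 1)) = 1"
  shows "cmv_L \<alpha> ** dagger (cmv_L \<alpha>) = (mat 1 :: 'n::{finite,linorder} cmat)"
proof (rule unitaryI_idx)
  let ?X = "\<lambda>b. Xi CARD('n) \<alpha> (2 * b)"
  let ?K = "\<lambda>p q. if p div 2 = q div 2 then ?X (p div 2) (p mod 2) (q mod 2) else 0"
  show "cmv_L \<alpha> $ i $ j = ?K (idx i) (idx j)"
    for i j :: 'n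
    by (simp add: cmv_L_def Let_def)
  fix p q :: nat
  assume pq: "p < CARD('n)" "q < CARD('n)"
  show "(\<Sum>m<CARD('n). ?K p m * cnj (?K q m)) = (if p = q then 1 else 0)"
  proof (rule block_unitary[where K = ?K and s = 0 and X = ?X])
    fix b assume "2 * b + 1 = CARD('n) + 0"
    then have "2 * b = CARD('n) - 1"
      by simp
    then show "?X b 0 0 * cnj (?X b 0 0) = 1"
      using assms(2) complex_norm_square[of "\<alpha> (CARD('n) - 1)"] by (simp add: Xi_def mult.commute)
  next
    fix b a c :: nat
    assume "2 * b + 1 < CARD('n) + 0" "a < 2" "c < 2"
    then show "?X b a 0 * cnj (?X b c 0) + ?X b a 1 * cnj (?X b c 1) = (if a = c then 1 else 0)"
      using assms(1) by (intro Xi_unitary) simp_all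
  qed (use pq in simp_all)
qed

lemma cmv_M_unitary:
  assumes "\<forall>k < CARD('n) - 1. cmod (\<alpha> k) < 1" "cmod (\<alpha> (CARD('n) - 1)) = 1"
  shows "cmv_M \<alpha> ** dagger (cmv_M \<alpha>) = (mat 1 :: 'n::{finite,linorder} cmat)"
proof (rule unitaryI_idx)
  \<comment> \<open>After the shift by one, block 0 retains only its last entry, the 1 of the
    leading block; a later block \<open>b\<close> is the one with parameter index
    \<open>2 * b - 1\<close>.\<close>
  let ?X = "\<lambda>b. if b = 0 then \<lambda>_ _. 1 else Xi CARD('n) \<alpha> (2 * (b - 1) + 1)"
  let ?K = "\<lambda>p q. if (p + 1) div 2 = (q + 1) div 2
    then ?X ((p + 1) div 2) ((p + 1) mod 2) ((q + 1) mod 2) else 0"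
  have K: "(if p = 0 \<and> q = 0 then 1 else if p = 0 \<or> q = 0 then 0
      else if (p - 1) div 2 = (q - 1) div 2
      then Xi CARD('n) \<alpha> (2 * ((p - 1) div 2) + 1) ((p - 1) mod 2) ((q - 1) mod 2) else 0) = ?K p q" for p q
  proof (cases p)
    case 0
    then show ?thesis by (cases q) auto
  next
    case (Suc p')
    then show ?thesis by (cases q) auto
  qed
  show "cmv_M \<alpha> $ i $ j = ?K (idx i) (idx j)" for i j :: 'n
    by (simp only: cmv_M_def Let_def vec_lambda_beta K)
  fix p q :: nat
  assume pq: "p < CARD('n)" "q < CARD('n)"
  show "(\<Sum>m<CARD('n). ?K p m * cnj (?K q m)) = (if p = q then 1 else 0)"
  proof (rule block_unitary[where K = ?K and s = 1 and X = ?X])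
    fix b assume "2 * b + 1 = CARD('n) + 1"
    \<comment> \<open>The cut last block is never the leading one, since the index type is nonempty;
      it carries the unimodular parameter.\<close>
    then have "b \<noteq> 0" "2 * (b - 1) + 1 = CARD('n) - 1"
      using zero_less_card_finite[where 'a = 'n] by linarith+
    then show "?X b 0 0 * cnj (?X b 0 0) = 1"
      using assms(2) complex_norm_square[of "\<alpha> (CARD('n) - 1)"] by (simp add: Xi_def mult.commute)
  next
    fix b a c :: nat
    assume "1 \<le> 2 * b" "2 * b + 1 < CARD('n) + 1" "a < 2" "c < 2"
    then have "b \<noteq> 0" "2 * (b - 1) + 1 < CARD('n) - 1"
      by auto
    then show "?X b a 0 * cnj (?X b c 0) + ?X b a 1 * cnj (?X b c 1) = (if a = c then 1 else 0)"
      using Xi_unitary[of "2 * (b - 1) + 1" "CARD('n)" \<alpha> a c] assms(1) \<open>a < 2\<close> \<open>c < 2\<close> by simp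
  qed (use pq in simp_all)
qed

lemma is_CMV_unitary:
  assumes "is_CMV C"
  shows "C ** dagger C = mat 1"
proof -
  obtain \<alpha> where \<alpha>: "\<forall>k < CARD('a) - 1. cmod (\<alpha> k) < 1" "cmod (\<alpha> (CARD('a) - 1)) = 1"
    and C: "C = cmv_L \<alpha> ** cmv_M \<alpha>"
    using assms unfolding is_CMV_def by blast
  have "C ** dagger C = cmv_L \<alpha> ** (cmv_M \<alpha> ** dagger (cmv_M \<alpha>)) ** dagger (cmv_L \<alpha>)"
    by (simp add: C dagger_mult matrix_mul_assoc)
  also have "\<dots> = mat 1"
    by (simp add: cmv_M_unitary[OF \<alpha>] cmv_L_unitary[OF \<alpha>])
  finally show ?thesis .
qed

text \<open>In the third conjunct the CMV form is imposed at the single time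
  \<open>t\<^sub>0\<close> and enters through unitarity, which the flow carries along the interval
  \<open>T\<close>.\<close>

theorem proposition6p3:
  fixes f g :: "complex poly"
    and \<phi> \<psi> :: "'n::{finite,linorder} cmat \<Rightarrow> real"
    and F :: "complex \<Rightarrow> real"
  assumes \<phi>: "\<phi> = (\<lambda>B. Im (trace (matrix_poly f B)))"
    and \<psi>: "\<psi> = (\<lambda>B. Re (cinner e1 (matrix_poly g B *v e1)))"
    and F: "F = (\<lambda>z. 2 * Re (z * poly (pderiv f) z))"
  shows
    "(\<forall>B. poisson \<phi> \<psi> B =
        Re (cinner e1 ((B ** matrix_poly (pderiv f) B **
                          (matrix_poly g B + dagger (matrix_poly g B))) *v e1))
        - 2 * \<psi> B * Re (cinner e1 ((B ** matrix_poly (pderiv f) B) *v e1)))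
   \<and> (\<forall>T B. open T \<and> hamiltonian_flow \<phi> T B \<longrightarrow>
        (\<forall>t\<in>T. ((\<lambda>s. \<psi> (B s)) has_real_derivative
           Re (cinner e1 ((B t ** matrix_poly (pderiv f) (B t) **
                             (matrix_poly g (B t) + dagger (matrix_poly g (B t)))) *v e1))
           - 2 * \<psi> (B t) * Re (cinner e1 ((B t ** matrix_poly (pderiv f) (B t)) *v e1))) (at t)))
   \<and> (\<forall>T C t\<^sub>0 \<mu>. open T \<and> is_interval T \<and> hamiltonian_flow \<phi> T C \<and> t\<^sub>0 \<in> T \<and> is_CMV (C t\<^sub>0) \<and>
        (\<forall>t\<in>T. is_spectral_measure (C t) e1 (\<mu> t)) \<longrightarrow>
        (\<forall>G :: complex \<Rightarrow> real. \<forall>t\<in>T.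
           ((\<lambda>s. \<integral>z. G z \<partial>\<mu> s) has_real_derivative
              (\<integral>z. F z * G z \<partial>\<mu> t) - (\<integral>z. F z \<partial>\<mu> t) * (\<integral>z. G z \<partial>\<mu> t)) (at t)))"
proof (intro conjI allI impI ballI)
  fix B
  show "poisson \<phi> \<psi> B =
      Re (cinner e1 ((B ** matrix_poly (pderiv f) B **
                        (matrix_poly g B + dagger (matrix_poly g B))) *v e1))
      - 2 * \<psi> B * Re (cinner e1 ((B ** matrix_poly (pderiv f) B) *v e1))"
    unfolding \<phi> \<psi> by (rule poisson_spectral)
next
  fix T B t
  assume "open T \<and> hamiltonian_flow \<phi> T B" "t \<in> T"
  then show "((\<lambda>s. \<psi> (B s)) has_real_derivative
         Re (cinner e1 ((B t ** matrix_poly (pderiv f) (B t) **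
                           (matrix_poly g (B t) + dagger (matrix_poly g (B t)))) *v e1))
         - 2 * \<psi> (B t) * Re (cinner e1 ((B t ** matrix_poly (pderiv f) (B t)) *v e1))) (at t)"
    unfolding \<phi> \<psi> by (intro flow_spectral_derivative) auto
next
  fix T C t\<^sub>0 \<mu> t and G :: "complex \<Rightarrow> real"
  assume "open T \<and> is_interval T \<and> hamiltonian_flow \<phi> T C \<and> t\<^sub>0 \<in> T \<and> is_CMV (C t\<^sub>0) \<and>
      (\<forall>t\<in>T. is_spectral_measure (C t) e1 (\<mu> t))" "t \<in> T"
  then show "((\<lambda>s. \<integral>z. G z \<partial>\<mu> s) has_real_derivative
            (\<integral>z. F z * G z \<partial>\<mu> t) - (\<integral>z. F z \<partial>\<mu> t) * (\<integral>z. G z \<partial>\<mu> t)) (at t)"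
    unfolding F \<phi> by (intro spectral_measure_derivative[of T f C t\<^sub>0]) (auto intro: is_CMV_unitary)
qed

end
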